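(* Let $k$ be an algebraically closed field and $Q_3$ the $3$-Kronecker quiver (two vertices $x,y$, three arrows from $x$ to $y$). For $i\ge 0$ let $U^{(i)}_{Q_3}(3,3)\subseteq (k^{3\times 3})^3$ be the set of all triples $m=(m_1,m_2,m_3)$ such that the corresponding $Q_3$-representation $\operatorname{rep}m$ of dimension vector $(3,3)$ is indecomposable with $\dim_k\operatorname{End}_{Q_3}(\operatorname{rep}m)=i$. Then every irreducible component of every non-empty $U^{(i)}_{Q_3}(3,3)$ contains a point $m$ such that $\operatorname{rep}m$ is a tree representation.
   Context: For $m=(m_1,m_2,m_3)$, $\operatorname{rep}m$ is the representation with $k^3$ at both vertices and the three arrows represented by $m_1,m_2,m_3$. Irreducible components refer to the Zariski topology. Tree representations: a basis of a representation $M$ of a quiver $K$ is a family $\mathcal B=(\mathcal B_x)_{x\in K_0}$ with $\mathcal B_x$ a $k$-basis of $M(x)$. The coefficient quiver $\Gamma(M,\mathcal B)$ has as vertices the disjoint union of the $\mathcal B_x$, and an arrow $(\alpha,b,b')$ from $b\in\mathcal B_x$ to $b'\in\mathcal B_y$ for every arrow $\alpha:x\to y$ of $K$ such that the coefficient of $b'$ in $M(\alpha)(b)$ is non-zero. $M$ is a tree representation if there is a basis $\mathcal B$ such that the underlying graph of $\Gamma(M,\mathcal B)$ is a tree (connected without cycles). *)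

theory Defs
  imports
    "Graph_Theory.Digraph_Component"
    "HOL-Computational_Algebra.Polynomial"
    "HOL-Library.Function_Algebras"
    "HOL-Analysis.Analysis"
begin

section \<open>Irreducible components of topological spaces\<close>

definition irreducible_space :: "'p topology \<Rightarrow> bool" where
  "irreducible_space X \<longleftrightarrow> topspace X \<noteq> {} \<and>
     (\<forall>C D. closedin X C \<longrightarrow> closedin X D \<longrightarrow> C \<union> D = topspace X \<longrightarrow>
        C = topspace X \<or> D = topspace X)"

definition irreducible_components_of :: "'p topology \<Rightarrow> 'p set set" where
  "irreducible_components_of X =
     {C. C \<subseteq> topspace X \<and> irreducible_space (subtopology X C) \<and>
         (\<forall>D. D \<subseteq> topspace X \<longrightarrow> irreducible_space (subtopology X D) \<longrightarrow> C \<subseteq> D \<longrightarrow> C = D)}"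

section \<open>Zariski topology\<close>

text \<open>The algebra of functions generated by a set \<open>X\<close> of coordinate functions.\<close>

inductive_set polynomial_functions :: "('p \<Rightarrow> 'k::field) set \<Rightarrow> ('p \<Rightarrow> 'k) set"
  for X :: "('p \<Rightarrow> 'k) set" where
  coord: "f \<in> X \<Longrightarrow> f \<in> polynomial_functions X"
| const: "(\<lambda>_. c) \<in> polynomial_functions X"
| add: "f \<in> polynomial_functions X \<Longrightarrow> g \<in> polynomial_functions X \<Longrightarrow>
    (\<lambda>p. f p + g p) \<in> polynomial_functions X"
| mult: "f \<in> polynomial_functions X \<Longrightarrow> g \<in> polynomial_functions X \<Longrightarrow>
    (\<lambda>p. f p * g p) \<in> polynomial_functions X"

definition zero_locus :: "('p \<Rightarrow> 'k::field) set \<Rightarrow> 'p set" where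
  "zero_locus S = {p. \<forall>f\<in>S. f p = 0}"

definition zariski :: "('p \<Rightarrow> 'k::field) set \<Rightarrow> 'p topology" where
  "zariski X = topology (\<lambda>U. \<exists>S\<subseteq>polynomial_functions X. U = - zero_locus S)"

lemma istopology_zariski:
  "istopology (\<lambda>U. \<exists>S\<subseteq>polynomial_functions X. U = - zero_locus S)"
  unfolding istopology_def
proof (intro conjI allI impI)
  fix U V
  assume "\<exists>S\<subseteq>polynomial_functions X. U = - zero_locus S"
    and "\<exists>S\<subseteq>polynomial_functions X. V = - zero_locus S"
  then obtain S T where S: "S \<subseteq> polynomial_functions X" "U = - zero_locus S"
    and T: "T \<subseteq> polynomial_functions X" "V = - zero_locus T" by auto
  let ?R = "{\<lambda>p. f p * g p | f g. f \<in> S \<and> g \<in> T}"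
  have "?R \<subseteq> polynomial_functions X"
    using S T by (auto intro!: polynomial_functions.mult)
  moreover have "U \<inter> V = - zero_locus ?R"
    unfolding S T zero_locus_def by (auto; metis mult_eq_0_iff)
  ultimately show "\<exists>S\<subseteq>polynomial_functions X. U \<inter> V = - zero_locus S" by blast
next
  fix \<U>
  assume "\<forall>U\<in>\<U>. \<exists>S\<subseteq>polynomial_functions X. U = - zero_locus S"
  then obtain S where S: "\<And>U. U \<in> \<U> \<Longrightarrow> S U \<subseteq> polynomial_functions X \<and> U = - zero_locus (S U)"
    by metis
  then have "\<Union>\<U> = - zero_locus (\<Union>U\<in>\<U>. S U)"
    unfolding zero_locus_def by blast
  moreover have "(\<Union>U\<in>\<U>. S U) \<subseteq> polynomial_functions X" using S by blast
  ultimately show "\<exists>S\<subseteq>polynomial_functions X. \<Union>\<U> = - zero_locus S" by blast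
qed

lemma openin_zariski:
  "openin (zariski X) U \<longleftrightarrow> (\<exists>S\<subseteq>polynomial_functions X. U = - zero_locus S)"
  by (simp add: zariski_def istopology_zariski topology_inverse')

lemma topspace_zariski [simp]: "topspace (zariski X) = UNIV"
proof -
  have "openin (zariski X) UNIV"
    unfolding openin_zariski
    by (rule exI[of _ "{\<lambda>_. 1}"]) (auto simp: zero_locus_def intro: polynomial_functions.const)
  then show ?thesis using openin_subset by blast
qed

lemma closedin_zariski:
  "closedin (zariski X) C \<longleftrightarrow> (\<exists>S\<subseteq>polynomial_functions X. C = zero_locus S)"
  unfolding closedin_def topspace_zariski openin_zariski Compl_eq_Diff_UNIV[symmetric] by auto

section \<open>Quiver representations\<close>

text \<open>
  A quiver is a \<^typ>\<open>('x, 'a) pre_digraph\<close>. We consider representations with the space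
  \<open>k\<^sup>n\<close> at every vertex; such a representation is given by the family of matrices of its
  arrows. A subrepresentation is given by a family of subspaces, which may vary with the vertex.
\<close>

definition subrep ::
  "('x, 'a) pre_digraph \<Rightarrow> ('a \<Rightarrow> 'k::field^'n^'n) \<Rightarrow> ('x \<Rightarrow> ('k^'n) set) \<Rightarrow> bool" where
  "subrep K M N \<longleftrightarrow>
     (\<forall>x\<in>verts K. vec.subspace (N x)) \<and>
     (\<forall>a\<in>arcs K. \<forall>v\<in>N (tail K a). M a *v v \<in> N (head K a))"

text \<open>
  As \<open>n \<noteq> 0\<close>, the first conjunct says that the representation is nonzero.
\<close>

definition indecomposable_rep ::
  "('x, 'a) pre_digraph \<Rightarrow> ('a \<Rightarrow> 'k::field^'n^'n) \<Rightarrow> bool" where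
  "indecomposable_rep K M \<longleftrightarrow> verts K \<noteq> {} \<and>
     (\<forall>N N'. subrep K M N \<longrightarrow> subrep K M N' \<longrightarrow>
        (\<forall>x\<in>verts K. N x \<inter> N' x = {0} \<and> {v + v' | v v'. v \<in> N x \<and> v' \<in> N' x} = UNIV) \<longrightarrow>
        (\<forall>x\<in>verts K. N x = {0}) \<or> (\<forall>x\<in>verts K. N' x = {0}))"

text \<open>
  Endomorphisms are set to zero off the vertices of the quiver, so that the endomorphism space
  is not enlarged by irrelevant values.
\<close>

definition End_rep ::
  "('x, 'a) pre_digraph \<Rightarrow> ('a \<Rightarrow> 'k::field^'n^'n) \<Rightarrow> ('x \<Rightarrow> 'k^'n \<Rightarrow> 'k^'n) set" where
  "End_rep K M =
     {f. (\<forall>x\<in>verts K. Vector_Spaces.linear (*s) (*s) (f x)) \<and>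
         (\<forall>x. x \<notin> verts K \<longrightarrow> f x = 0) \<and>
         (\<forall>a\<in>arcs K. \<forall>v. f (head K a) (M a *v v) = M a *v f (tail K a) v)}"

definition scale_family :: "'k::field \<Rightarrow> ('x \<Rightarrow> 'k^'n \<Rightarrow> 'k^'n) \<Rightarrow> 'x \<Rightarrow> 'k^'n \<Rightarrow> 'k^'n" where
  "scale_family c f = (\<lambda>x v. c *s f x v)"

interpretation family: vector_space scale_family
  by unfold_locales
    (auto simp: scale_family_def fun_eq_iff vec.scale_right_distrib vec.scale_left_distrib)

definition dim_End :: "('x, 'a) pre_digraph \<Rightarrow> ('a \<Rightarrow> 'k::field^'n^'n) \<Rightarrow> nat" where
  "dim_End K M = family.dim (End_rep K M)"

section \<open>Tree representations\<close>

definition basis_of_rep :: "('x, 'a) pre_digraph \<Rightarrow> ('x \<Rightarrow> ('k::field^'n) set) \<Rightarrow> bool" where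
  "basis_of_rep K B \<longleftrightarrow> (\<forall>x\<in>verts K. vec.independent (B x) \<and> vec.span (B x) = UNIV)"

definition coefficient_quiver ::
  "('x, 'a) pre_digraph \<Rightarrow> ('a \<Rightarrow> 'k::field^'n^'n) \<Rightarrow> ('x \<Rightarrow> ('k^'n) set) \<Rightarrow>
     ('x \<times> ('k^'n), 'a \<times> ('k^'n) \<times> ('k^'n)) pre_digraph" where
  "coefficient_quiver K M B =
     \<lparr> verts = (SIGMA x:verts K. B x),
       arcs = {(a, b, b'). a \<in> arcs K \<and> b \<in> B (tail K a) \<and> b' \<in> B (head K a) \<and>
                 vec.representation (B (head K a)) (M a *v b) b' \<noteq> 0},
       tail = (\<lambda>(a, b, b'). (tail K a, b)),
       head = (\<lambda>(a, b, b'). (head K a, b')) \<rparr>"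

text \<open>
  Cycles of the underlying undirected multigraph: closed walks of length at least one without
  repeated vertices or edges, in which edge \<open>es ! i\<close> joins \<open>vs ! i\<close> to its cyclic successor.
  A loop is a cycle of length one and a pair of parallel or antiparallel arrows is a cycle of
  length two. The predicates \<open>forest\<close> and \<open>tree\<close> of the graph library exclude only directed
  cycles.
\<close>

definition undirected_cycle :: "('x, 'a) pre_digraph \<Rightarrow> 'x list \<Rightarrow> 'a list \<Rightarrow> bool" where
  "undirected_cycle G vs es \<longleftrightarrow>
     es \<noteq> [] \<and> length vs = length es \<and> distinct vs \<and> distinct es \<and> set es \<subseteq> arcs G \<and>
     (\<forall>i<length es. {tail G (es ! i), head G (es ! i)} = {vs ! i, vs ! (Suc i mod length es)})"

definition underlying_tree :: "('x, 'a) pre_digraph \<Rightarrow> bool" where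
  "underlying_tree G \<longleftrightarrow> Digraph_Component.connected G \<and> (\<nexists>vs es. undirected_cycle G vs es)"

definition tree_rep :: "('x, 'a) pre_digraph \<Rightarrow> ('a \<Rightarrow> 'k::field^'n^'n) \<Rightarrow> bool" where
  "tree_rep K M \<longleftrightarrow> (\<exists>B. basis_of_rep K B \<and> underlying_tree (coefficient_quiver K M B))"

section \<open>The 3-Kronecker quiver\<close>

datatype kronecker_vertex = Source | Target

definition kronecker3 :: "(kronecker_vertex, 3) pre_digraph" where
  "kronecker3 = \<lparr> verts = UNIV, arcs = UNIV, tail = (\<lambda>_. Source), head = (\<lambda>_. Target) \<rparr>"

text \<open>A triple \<open>m\<close> of matrices has the components \<open>m $ 1\<close>, \<open>m $ 2\<close>, \<open>m $ 3\<close>.\<close>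

definition rep :: "'k::field^3^3^3 \<Rightarrow> 3 \<Rightarrow> 'k^3^3" where
  "rep m = (\<lambda>a. m $ a)"

definition zariski_triples :: "('k::field^3^3^3) topology" where
  "zariski_triples = zariski {\<lambda>m. m $ a $ r $ c | a r c. True}"

definition U_kronecker :: "nat \<Rightarrow> ('k::field^3^3^3) set" where
  "U_kronecker i = {m. indecomposable_rep kronecker3 (rep m) \<and> dim_End kronecker3 (rep m) = i}"

end

theory Submission
  imports Defs
begin

text \<open>
  The endomorphism algebra of an indecomposable \<open>m\<close> is local, and its radical acts faithfully at
  each vertex by nilpotent \<open>3 \<times> 3\<close> matrices. Up to change of bases at the two vertices only six
  algebras of pairs of matrices occur: either a nilpotent endomorphism has nonzero square, and the
  algebra is generated by a Jordan block, or all nilpotent endomorphisms have square zero, and the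
  radical is spanned by at most two pairs of matrix units. For each of the six algebras \<open>E\<close>, the
  triples whose endomorphism algebra is conjugate to \<open>E\<close> form an irreducible subset, because the
  triples commuting with \<open>E\<close> form a linear space in which having no further endomorphisms is an open
  condition. Hence the sets \<open>U\<^sup>(\<^sup>i\<^sup>)\<close> are finite unions of such subsets, each irreducible component
  contains one of them, and each of them contains a tree representation.
\<close>

section \<open>Representations as triples of matrices\<close>

text \<open>Faithfulness at each vertex comes from idempotents: if \<open>(F, 0)\<close> is a
  nonzero endomorphism, a rank-one idempotent \<open>P\<close> with image inside that of
  \<open>F\<close> gives an endomorphism \<open>(P, 0)\<close>, contradicting indecomposability. So
  either matrix of an endomorphism determines the other, and since the bases at the two vertices are
  independent, the two matrices can be normalised separately. In the square-zero case one nilpotent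
  endomorphism is normalised to the matrix unit E31 at both vertices. Any other nilpotent one must
  keep square zero after E31 is added, which leaves, modulo E31, only multiples of E21 or of E32 at
  each vertex. Of the four combinations, E32 at the source with E21 at the target kills the third
  column of every arrow and is impossible. Locality and dim End depend only on the endomorphism
  algebra, so a piece meeting \<open>U_kronecker i\<close> lies inside it. A component is the
  closure of a piece within \<open>U_kronecker i\<close>, so one explicit 0/1 triple per algebra is
  enough. Algebraic closedness supplies eigenvalues and an infinite field, hence generic points on
  polynomial curves.\<close>

definition intertwiners :: "'k::field^3^3^3 \<Rightarrow> (('k^3^3) \<times> ('k^3^3)) set" where
  "intertwiners m = {(F, G). \<forall>a. G ** m $ a = m $ a ** F}"

definition endo_of_pair :: "('k::field^3^3) \<times> ('k^3^3) \<Rightarrow> kronecker_vertex \<Rightarrow> 'k^3 \<Rightarrow> 'k^3" where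
  "endo_of_pair p = (\<lambda>x v. (case x of Source \<Rightarrow> fst p | Target \<Rightarrow> snd p) *v v)"

lemma kronecker3_sel [simp]:
  "verts kronecker3 = UNIV" "arcs kronecker3 = UNIV"
  "tail kronecker3 a = Source" "head kronecker3 a = Target"
  by (simp_all add: kronecker3_def)

lemma all_kronecker_vertex: "(\<forall>x. P x) \<longleftrightarrow> P Source \<and> P Target"
  by (metis kronecker_vertex.exhaust)

lemma End_rep_kronecker3: "End_rep kronecker3 (rep m) = endo_of_pair ` intertwiners m"
proof (intro equalityI subsetI)
  fix f assume f: "f \<in> End_rep kronecker3 (rep m)"
  have lin: "Vector_Spaces.linear (*s) (*s) (f x)" for x
    using f by (auto simp: End_rep_def)
  let ?p = "(matrix (f Source), matrix (f Target))"
  have "f = endo_of_pair ?p"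
    using lin by (auto simp: fun_eq_iff endo_of_pair_def matrix_works split: kronecker_vertex.splits)
  moreover have "?p \<in> intertwiners m"
    using f lin
    by (auto simp: intertwiners_def End_rep_def matrix_eq matrix_works rep_def
        simp flip: matrix_vector_mul_assoc)
  ultimately show "f \<in> endo_of_pair ` intertwiners m" by blast
next
  fix f assume "f \<in> endo_of_pair ` intertwiners m"
  then show "f \<in> End_rep kronecker3 (rep m)"
    by (auto simp: End_rep_def endo_of_pair_def intertwiners_def rep_def matrix_vector_mul_assoc)
qed

text \<open>An idempotent endomorphism splits the representation into image and kernel; conversely,
  the projections belonging to a decomposition form an idempotent endomorphism.\<close>

lemma indecomposable_rep_kronecker3:
  "indecomposable_rep kronecker3 (rep m) \<longleftrightarrow>
     (\<forall>(F, G)\<in>intertwiners m. F ** F = F \<longrightarrow> G ** G = G \<longrightarrow>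
        (F, G) = (0, 0) \<or> (F, G) = (mat 1, mat 1))" (is "?L \<longleftrightarrow> ?R")
proof
  assume L: ?L
  show ?R
  proof (intro ballI, clarify)
    fix F G assume FG: "(F, G) \<in> intertwiners m" and idem: "F ** F = F" "G ** G = G"
      and ne: "\<not> (F = mat 1 \<and> G = mat 1)"
    define P where "P x = (case x of Source \<Rightarrow> F | Target \<Rightarrow> G)" for x
    define N where "N x = range ((*v) (P x))" for x
    define N' where "N' x = {v. P x *v v = 0}" for x
    have PP: "P x *v (P x *v v) = P x *v v" for x v
      using idem by (cases x) (simp_all add: P_def matrix_vector_mul_assoc)
    have comm: "P Target *v (m $ a *v v) = m $ a *v (P Source *v v)" for a v
      using FG by (simp add: P_def intertwiners_def matrix_vector_mul_assoc)
    have "vec.subspace (N x)" for x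
      unfolding N_def using vec.linear_subspace_image[OF matrix_vector_mul_linear_gen vec.subspace_UNIV] .
    moreover have "vec.subspace (N' x)" for x
      unfolding N'_def by (rule vec.linear_subspace_kernel[OF matrix_vector_mul_linear_gen])
    ultimately have "subrep kronecker3 (rep m) N" "subrep kronecker3 (rep m) N'"
      using comm[symmetric] by (auto simp: subrep_def rep_def N_def)
        (auto simp: N'_def comm)
    moreover have "N x \<inter> N' x = {0}" for x
      using PP by (auto simp: N_def N'_def image_iff intro!: exI[of _ 0])
    moreover have "{v + v' | v v'. v \<in> N x \<and> v' \<in> N' x} = UNIV" for x
    proof -
      have "w = P x *v w + (w - P x *v w)" "P x *v w \<in> N x" "w - P x *v w \<in> N' x" for w
        by (auto simp: N_def N'_def PP matrix_vector_mult_diff_distrib)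
      then show ?thesis by blast
    qed
    ultimately have "(\<forall>x. N x = {0}) \<or> (\<forall>x. N' x = {0})"
      using L unfolding indecomposable_rep_def by simp
    then show "F = 0 \<and> G = 0"
    proof
      assume "\<forall>x. N x = {0}"
      then have "P x *v v = 0" for x v by (auto simp: N_def)
      then have "F *v v = 0" "G *v v = 0" for v
        by (metis P_def kronecker_vertex.case)+
      then show ?thesis by (simp add: matrix_eq)
    next
      assume N': "\<forall>x. N' x = {0}"
      have "P x *v v = v" for x v
      proof -
        have "v - P x *v v \<in> N' x" by (simp add: N'_def PP matrix_vector_mult_diff_distrib)
        then show ?thesis using N' by simp
      qed
      then have "F *v v = v" "G *v v = v" for v
        by (metis P_def kronecker_vertex.case)+
      then show ?thesis using ne by (simp add: matrix_eq)
    qed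
  qed
next
  assume R: ?R
  have "(\<forall>x. N x = {0}) \<or> (\<forall>x. N' x = {0})"
    if N: "subrep kronecker3 (rep m) N" and N': "subrep kronecker3 (rep m) N'"
      and compl: "\<And>x. N x \<inter> N' x = {0} \<and> {v + v' | v v'. v \<in> N x \<and> v' \<in> N' x} = UNIV" for N N'
  proof -
    \<comment> \<open>The projection onto \<open>N x\<close> along \<open>N' x\<close>. Uniqueness
      of the component is \<open>p_eq\<close>, existence is \<open>p\<close>.\<close>
    define p where "p x v = (THE n. n \<in> N x \<and> v - n \<in> N' x)" for x v
    have sub: "vec.subspace (N x)" "vec.subspace (N' x)" for x
      using N N' by (auto simp: subrep_def)
    have p_eq: "p x v = n" if "n \<in> N x" "v - n \<in> N' x" for x v n
      unfolding p_def
    proof (rule the_equality)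
      fix n' assume n': "n' \<in> N x \<and> v - n' \<in> N' x"
      have "n' - n \<in> N x" using n' that sub vec.subspace_diff by blast
      moreover have "(v - n) - (v - n') \<in> N' x" using n' that sub vec.subspace_diff by blast
      then have "n' - n \<in> N' x" by simp
      ultimately have "n' - n \<in> {0}" using compl[of x] by blast
      then show "n' = n" by simp
    qed (use that in simp)
    have p: "p x v \<in> N x" "v - p x v \<in> N' x" for x v
    proof -
      have "v \<in> {v + v' | v v'. v \<in> N x \<and> v' \<in> N' x}" using compl[of x] by simp
      then obtain n n' where nn: "v = n + n'" "n \<in> N x" "n' \<in> N' x" by blast
      then have "p x v = n" by (intro p_eq) auto
      then show "p x v \<in> N x" "v - p x v \<in> N' x" using nn by auto
    qed
    have lin: "Vector_Spaces.linear (*s) (*s) (p x)" for x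
    proof (intro Vector_Spaces.linear_iff[THEN iffD2] conjI allI)
      fix u v
      have "(u - p x u) + (v - p x v) \<in> N' x"
        using p(2) vec.subspace_add[OF sub(2)] by blast
      moreover have "p x u + p x v \<in> N x" using p(1) vec.subspace_add[OF sub(1)] by blast
      ultimately show "p x (u + v) = p x u + p x v" by (intro p_eq) (auto simp: algebra_simps)
    next
      fix c v
      have "c *s (v - p x v) \<in> N' x" using p(2) vec.subspace_scale[OF sub(2)] by blast
      moreover have "c *s p x v \<in> N x" using p(1) vec.subspace_scale[OF sub(1)] by blast
      ultimately show "p x (c *s v) = c *s p x v"
        by (intro p_eq) (auto simp: vec.scale_right_diff_distrib)
    qed (simp_all add: vec.vector_space_axioms)
    have idem: "p x (p x v) = p x v" for x v
      using p(1) vec.subspace_0[OF sub(2)] by (intro p_eq) auto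
    have comm: "p Target (m $ a *v v) = m $ a *v p Source v" for a v
    proof (rule p_eq)
      show "m $ a *v p Source v \<in> N Target"
        using N p by (auto simp: subrep_def rep_def)
      have "m $ a *v (v - p Source v) \<in> N' Target"
        using N' p by (auto simp: subrep_def rep_def)
      then show "m $ a *v v - m $ a *v p Source v \<in> N' Target"
        by (simp add: matrix_vector_mult_diff_distrib)
    qed
    let ?F = "matrix (p Source)" and ?G = "matrix (p Target)"
    have "(?F, ?G) \<in> intertwiners m"
      by (simp add: intertwiners_def matrix_eq matrix_works lin comm flip: matrix_vector_mul_assoc)
    moreover have "?F ** ?F = ?F" "?G ** ?G = ?G"
      by (simp_all add: matrix_eq matrix_works lin idem flip: matrix_vector_mul_assoc)
    ultimately have "(?F = 0 \<and> ?G = 0) \<or> (?F = mat 1 \<and> ?G = mat 1)"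
      using R by fastforce
    then have "(\<forall>x v. p x v = 0) \<or> (\<forall>x v. p x v = v)"
      unfolding all_kronecker_vertex using matrix_works[OF lin]
      by (metis matrix_vector_mul_lid matrix_vector_mult_0)
    then show ?thesis
    proof
      assume "\<forall>x v. p x v = 0"
      then have "n = 0" if "n \<in> N x" for x n
        using p_eq[of n x n] that vec.subspace_0[OF sub(2)] by simp
      then have "N x = {0}" for x using vec.subspace_0[OF sub(1)] by blast
      then show ?thesis by blast
    next
      assume "\<forall>x v. p x v = v"
      then have "n = 0" if "n \<in> N' x" for x n
        using p_eq[of 0 x n] that vec.subspace_0[OF sub(1)] by simp
      then have "N' x = {0}" for x using vec.subspace_0[OF sub(2)] by blast
      then show ?thesis by blast
    qed
  qed
  then show ?L unfolding indecomposable_rep_def by simp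
qed

lemma family_dim_image:
  assumes "Vector_Spaces.linear scale_family scale_family T" and "inj T"
  shows "family.dim (T ` S) = family.dim S"
proof -
  interpret T: Vector_Spaces.linear scale_family scale_family T by fact
  obtain B where B: "B \<subseteq> S" "family.independent B" "S \<subseteq> family.span B" "card B = family.dim S"
    using family.basis_exists[of S] by auto
  have "family.dim (T ` S) = card (T ` B)"
  proof (rule family.dim_unique)
    show "T ` B \<subseteq> T ` S" using B by blast
    show "T ` S \<subseteq> family.span (T ` B)" using B T.span_image by blast
    show "family.independent (T ` B)"
      using B assms(2) T.independent_inj_image by blast
  qed simp
  then show ?thesis
    using B card_image[of T B] assms(2) by (simp add: inj_on_subset)
qed

lemma intertwiners_conj:
  assumes "A' ** A = mat 1" "B ** B' = mat 1" "\<And>a. m $ a = A ** v $ a ** B"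
    and "(F, G) \<in> intertwiners v"
  shows "(B' ** F ** B, A ** G ** A') \<in> intertwiners m"
proof -
  have "A ** G ** A' ** (A ** v $ a ** B) = A ** v $ a ** B ** (B' ** F ** B)" for a
  proof -
    have "A ** G ** A' ** (A ** v $ a ** B) = A ** G ** (A' ** A) ** v $ a ** B"
      by (simp only: matrix_mul_assoc)
    also have "\<dots> = A ** (G ** v $ a) ** B"
      by (simp add: assms(1) matrix_mul_assoc)
    also have "\<dots> = A ** (v $ a ** F) ** B"
      using assms(4) by (simp add: intertwiners_def)
    also have "\<dots> = A ** v $ a ** (B ** B') ** F ** B"
      by (simp add: assms(2) matrix_mul_assoc)
    finally show ?thesis by (simp only: matrix_mul_assoc)
  qed
  then show ?thesis by (simp add: intertwiners_def assms(3))
qed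

lemma conj_sym:
  fixes A :: "'k::field^3^3"
  assumes "A' ** A = mat 1" "B ** B' = mat 1" "m = A ** v ** B"
  shows "v = A' ** m ** B'"
proof -
  have "A' ** m ** B' = (A' ** A) ** v ** (B ** B')"
    by (simp only: assms(3) matrix_mul_assoc)
  then show ?thesis by (simp add: assms)
qed

text \<open>Conjugation makes sense on all families of maps, where it is linear and injective; it
  carries one endomorphism space onto the other and so preserves its dimension.\<close>

lemma dim_End_conj:
  assumes inv: "A ** A' = mat 1" "A' ** A = mat 1" "B ** B' = mat 1" "B' ** B = mat 1"
    and m: "\<And>a. m $ a = A ** v $ a ** B"
  shows "dim_End kronecker3 (rep m) = dim_End kronecker3 (rep v)"
proof -
  define L R where "L x = (case x of Source \<Rightarrow> B' | Target \<Rightarrow> A)"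
    and "R x = (case x of Source \<Rightarrow> B | Target \<Rightarrow> A')" for x
  define T where "T f = (\<lambda>x w. L x *v f x (R x *v w))" for f
  have "Vector_Spaces.linear scale_family scale_family T"
    by unfold_locales
      (simp_all add: T_def scale_family_def fun_eq_iff matrix_vector_right_distrib
        vec.scale_left_distrib vector_scalar_commute)
  moreover have "inj T"
  proof (rule inj_on_inverseI)
    fix f
    have "R x ** L x = mat 1" "L x ** R x = mat 1" for x
      using inv by (cases x; simp add: L_def R_def)+
    then show "(\<lambda>x w. R x *v T f x (L x *v w)) = f"
      by (simp add: T_def matrix_vector_mul_assoc)
  qed
  moreover have "T ` endo_of_pair ` intertwiners v = endo_of_pair ` intertwiners m"
  proof -
    have T: "T (endo_of_pair (F, G)) = endo_of_pair (B' ** F ** B, A ** G ** A')" for F G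
      by (auto simp: T_def L_def R_def endo_of_pair_def fun_eq_iff matrix_vector_mul_assoc
          matrix_mul_assoc split: kronecker_vertex.splits)
    have v: "v $ a = A' ** m $ a ** B'" for a
      using conj_sym[OF inv(2,3) m] .
    have "p \<in> T ` endo_of_pair ` intertwiners v" if p: "p \<in> endo_of_pair ` intertwiners m" for p
    proof -
      obtain F G where FG: "(F, G) \<in> intertwiners m" "p = endo_of_pair (F, G)"
        using p by auto
      have *: "(B ** F ** B', A' ** G ** A) \<in> intertwiners v"
        using intertwiners_conj[OF inv(1,4) v FG(1)] .
      have "B' ** (B ** F ** B') ** B = F" "A ** (A' ** G ** A) ** A' = G"
        using conj_sym[OF inv(4,4) refl, of F] conj_sym[OF inv(1,1) refl, of G] by simp_all
      then have "T (endo_of_pair (B ** F ** B', A' ** G ** A)) = p"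
        by (simp add: T FG)
      then show ?thesis using * by blast
    qed
    moreover have "T p \<in> endo_of_pair ` intertwiners m" if "p \<in> endo_of_pair ` intertwiners v" for p
      using that intertwiners_conj[OF inv(2,3) m] T by force
    ultimately show ?thesis by blast
  qed
  ultimately show ?thesis
    using family_dim_image[of T "endo_of_pair ` intertwiners v"]
    by (simp add: dim_End_def End_rep_kronecker3)
qed

section \<open>A criterion for tree representations\<close>

text \<open>Each edge joins a child \<open>c e\<close> to a parent \<open>p e\<close>, and no vertex
  is the child of two edges. A deepest vertex of a cycle would be the child end of both of its cycle
  edges, so these coincide and the cycle is a loop, which the strict decrease of \<open>d\<close>
  excludes.\<close>

lemma rooted_tree_no_cycle:
  fixes d :: "'x \<Rightarrow> nat"
  assumes ends: "\<And>e. e \<in> arcs G \<Longrightarrow> {tail G e, head G e} = {c e, p e}"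
    and depth: "\<And>e. e \<in> arcs G \<Longrightarrow> d (p e) < d (c e)"
    and inj: "inj_on c (arcs G)"
  shows "\<not> undirected_cycle G vs es"
proof
  assume cyc: "undirected_cycle G vs es"
  define n where "n = length es"
  have n: "n > 0" "length vs = n" "distinct es" "set es \<subseteq> arcs G"
    and edge: "\<And>i. i < n \<Longrightarrow> {tail G (es ! i), head G (es ! i)} = {vs ! i, vs ! (Suc i mod n)}"
    using cyc by (auto simp: undirected_cycle_def n_def)
  have arc: "es ! i \<in> arcs G" if "i < n" for i using n that nth_mem[of i es] by (auto simp: n_def)
  obtain i where i: "i < n" and max: "\<And>j. j < n \<Longrightarrow> d (vs ! j) \<le> d (vs ! i)"
  proof -
    have "finite ((\<lambda>j. d (vs ! j)) ` {..<n})" "(\<lambda>j. d (vs ! j)) ` {..<n} \<noteq> {}" using n by auto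
    then have "Max ((\<lambda>j. d (vs ! j)) ` {..<n}) \<in> (\<lambda>j. d (vs ! j)) ` {..<n}" by (rule Max_in)
    then obtain i where "i < n" "Max ((\<lambda>j. d (vs ! j)) ` {..<n}) = d (vs ! i)" by auto
    then show thesis using that[of i] Max_ge[of "(\<lambda>j. d (vs ! j)) ` {..<n}"] by auto
  qed
  have child: "c (es ! j) = vs ! i" if j: "j < n" "i = j \<or> i = Suc j mod n" for j
  proof -
    obtain k where "k < n" "{c (es ! j), p (es ! j)} = {vs ! i, vs ! k}"
      using j(2)
    proof
      assume "i = j"
      then show thesis
        using that[of "Suc j mod n"] edge[of j] ends[OF arc[of j]] j(1) n(1) by simp
    next
      assume "i = Suc j mod n"
      then show thesis
        using that[of j] edge[of j] ends[OF arc[of j]] j(1) by auto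
    qed
    then show ?thesis
      using depth[OF arc[OF j(1)]] max[of k] by (auto simp: doubleton_eq_iff)
  qed
  \<comment> \<open>The cyclic predecessor of \<open>i\<close>; for a cycle of length one it is
    \<open>i\<close> itself.\<close>
  define j where "j = (if i = 0 then n - 1 else i - 1)"
  have j: "j < n" "i = Suc j mod n" using i by (auto simp: j_def)
  then have "es ! i = es ! j"
    using child[of i] child[of j] i arc inj by (metis inj_onD)
  then have "i = j" using n(3) i j by (simp add: nth_eq_iff_index_eq n_def)
  then have "{c (es ! i), p (es ! i)} = {vs ! i}"
    using edge[OF i] ends[OF arc[OF i]] j by auto
  then show False using depth[OF arc[OF i]] by (metis doubleton_eq_iff insert_absorb2 nat_neq_iff)
qed

text \<open>Every vertex other than the root is the child of some edge, whose parent is less deep;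
  induction on the depth leads to the root.\<close>

lemma rooted_tree_connected:
  fixes d :: "'x \<Rightarrow> nat"
  assumes ends: "\<And>e. e \<in> arcs G \<Longrightarrow> {tail G e, head G e} = {c e, p e}"
    and depth: "\<And>e. e \<in> arcs G \<Longrightarrow> d (p e) < d (c e)"
    and verts: "\<And>e. e \<in> arcs G \<Longrightarrow> tail G e \<in> verts G \<and> head G e \<in> verts G"
    and root: "r \<in> verts G" "\<And>v. v \<in> verts G \<Longrightarrow> v \<noteq> r \<Longrightarrow> v \<in> c ` arcs G"
  shows "Digraph_Component.connected G"
proof -
  let ?R = "rtrancl_on (verts G) (parcs (mk_symmetric G))"
  have step: "(p e, c e) \<in> parcs (mk_symmetric G)" "(c e, p e) \<in> parcs (mk_symmetric G)"
    "p e \<in> verts G" "c e \<in> verts G" if "e \<in> arcs G" for e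
    using ends[OF that] verts[OF that] that
    by (auto simp: parcs_mk_symmetric doubleton_eq_iff) metis+
  have "(r, v) \<in> ?R \<and> (v, r) \<in> ?R" if "v \<in> verts G" for v
    using that
  proof (induction "d v" arbitrary: v rule: less_induct)
    case less
    show ?case
    proof (cases "v = r")
      case False
      then obtain e where e: "e \<in> arcs G" "v = c e" using root less.prems by blast
      then have "(r, p e) \<in> ?R \<and> (p e, r) \<in> ?R" using less.hyps depth step by blast
      then show ?thesis
        using step[OF e(1)] e(2)
        by (meson rtrancl_on_into_rtrancl_on converse_rtrancl_on_into_rtrancl_on)
    qed (use root in auto)
  qed
  then have "(u, v) \<in> ?R" if "u \<in> verts G" "v \<in> verts G" for u v
    using that by (meson rtrancl_on_trans)
  then show ?thesis
    using root(1) by (auto simp: connected_def strongly_connected_def reachable_def)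
qed

definition std_basis :: "kronecker_vertex \<Rightarrow> ('k::field^3) set" where
  "std_basis x = range (\<lambda>i. axis i 1)"

lemma basis_of_rep_std_basis:
  "basis_of_rep kronecker3 (std_basis :: _ \<Rightarrow> ('k::field^3) set)"
proof -
  have "range (\<lambda>i. axis i 1) = (cart_basis :: ('k::field^3) set)"
    by (auto simp: cart_basis_def)
  then show ?thesis
    using independent_cart_basis span_cart_basis
    by (auto simp: basis_of_rep_def std_basis_def)
qed

lemma representation_std_basis:
  fixes v :: "'k::field^3"
  shows "vec.representation (std_basis x) v (axis i 1) = v $ i"
proof -
  have inj: "inj (\<lambda>i. axis i (1::'k) :: 'k^3)" by (rule injI) (metis axis_eq_axis one_neq_zero)
  define R where "R b = (\<Sum>i\<in>UNIV. if b = axis i 1 then v $ i else 0)" for b :: "'k^3"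
  have R: "R (axis j 1) = v $ j" for j
  proof -
    have "R (axis j 1) = (\<Sum>i\<in>UNIV. if i = j then v $ i else 0)"
      unfolding R_def by (rule sum.cong) (auto simp: axis_eq_axis)
    then show ?thesis by simp
  qed
  have R0: "b \<in> std_basis x" if "R b \<noteq> 0" for b
  proof (rule ccontr)
    assume "b \<notin> std_basis x"
    then have "R b = 0" unfolding R_def std_basis_def by (intro sum.neutral) auto
    then show False using that by simp
  qed
  have "vec.representation (std_basis x) v = R"
  proof (rule vec.representation_eqI)
    show "vec.independent (std_basis x :: ('k^3) set)" "v \<in> vec.span (std_basis x)"
      using basis_of_rep_std_basis[where 'k = 'k] by (auto simp: basis_of_rep_def kronecker3_def)
    show "b \<in> std_basis x" if "R b \<noteq> 0" for b
      using R0 that .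
    show "finite {b. R b \<noteq> 0}"
      by (rule finite_subset[of _ "std_basis x"])
        (use R0 in \<open>auto simp: std_basis_def\<close>)
    have "{b. R b \<noteq> 0} \<subseteq> std_basis x"
      using R0 by auto
    then have "(\<Sum>b | R b \<noteq> 0. R b *s b) = (\<Sum>b\<in>std_basis x. R b *s b)"
      by (intro sum.mono_neutral_left) (auto simp: std_basis_def)
    also have "\<dots> = (\<Sum>i\<in>UNIV. v $ i *s axis i 1)"
      unfolding std_basis_def using inj by (simp add: sum.reindex R)
    also have "\<dots> = v" by (rule basis_expansion)
    finally show "(\<Sum>b | R b \<noteq> 0. R b *s b) = v" .
  qed
  then show ?thesis by (simp add: R)
qed

lemma matrix_vector_mult_axis: "(A *v axis c 1) $ r = (A $ r $ c :: 'k::field)"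
  by (simp add: matrix_vector_mult_def axis_def if_distrib cong: if_cong)

text \<open>
  The matrix entries of a triple are the edges of a graph on the six vertices \<open>(x, i)\<close>;
  \<open>d\<close> is the distance from the root \<open>(Source, 1)\<close>, and each other vertex has exactly one edge
  towards the root.
\<close>

lemma tree_rep_if_depth:
  fixes m :: "'k::field^3^3^3" and d :: "kronecker_vertex \<Rightarrow> 3 \<Rightarrow> nat"
  assumes "\<forall>a r c. m $ a $ r $ c \<noteq> 0 \<longrightarrow> d Source c \<noteq> d Target r"
    and "\<forall>c a b r s. m $ a $ r $ c \<noteq> 0 \<longrightarrow> m $ b $ s $ c \<noteq> 0 \<longrightarrow>
      d Target r < d Source c \<longrightarrow> d Target s < d Source c \<longrightarrow> a = b \<and> r = s"
    and "\<forall>r a b c e. m $ a $ r $ c \<noteq> 0 \<longrightarrow> m $ b $ r $ e \<noteq> 0 \<longrightarrow>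
      d Source c < d Target r \<longrightarrow> d Source e < d Target r \<longrightarrow> a = b \<and> c = e"
    and "\<forall>c. c \<noteq> 1 \<longrightarrow> (\<exists>a r. m $ a $ r $ c \<noteq> 0 \<and> d Target r < d Source c)"
    and "\<forall>r. \<exists>a c. m $ a $ r $ c \<noteq> 0 \<and> d Source c < d Target r"
  shows "tree_rep kronecker3 (rep m)"
proof -
  note neq = assms(1)[rule_format] and uniq_Source = assms(2)[rule_format]
    and uniq_Target = assms(3)[rule_format] and ex_Source = assms(4)[rule_format]
    and ex_Target = assms(5)[rule_format]
  let ?G = "coefficient_quiver kronecker3 (rep m) (std_basis :: _ \<Rightarrow> ('k^3) set)"
  have inj: "axis i (1::'k) = (axis j 1 :: 'k^3) \<longleftrightarrow> i = j" for i j :: 3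
    by (simp add: axis_eq_axis)
  define ix where "ix b = (THE i. b = (axis i 1 :: 'k^3))" for b
  have ix: "ix (axis i 1) = i" for i
    unfolding ix_def by (simp add: inj)
  have arcs: "arcs ?G = {(a, axis c 1, axis r 1) | a c r. m $ a $ r $ c \<noteq> 0}"
    by (auto simp: coefficient_quiver_def kronecker3_def std_basis_def[of Source]
        std_basis_def[of Target] representation_std_basis[unfolded std_basis_def] rep_def
        matrix_vector_mult_axis inj)
  have verts: "verts ?G = {(x, axis i 1) | x i. True}"
    by (auto simp: coefficient_quiver_def kronecker3_def std_basis_def)
  have ends: "tail ?G (a, b, b') = (Source, b)" "head ?G (a, b, b') = (Target, b')" for a b b'
    by (simp_all add: coefficient_quiver_def kronecker3_def)
  define dep where "dep = (\<lambda>(x, b). d x (ix b))"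
  \<comment> \<open>\<open>up e\<close> says that the \<open>Target\<close> end is nearer to the
    root, so that the child of the edge is its tail.\<close>
  define up where "up = (\<lambda>(a::3, b, b'). d Target (ix b') < d Source (ix b))"
  define ch where "ch e = (if up e then tail ?G e else head ?G e)" for e
  define pa where "pa e = (if up e then head ?G e else tail ?G e)" for e
  have E: "{tail ?G e, head ?G e} = {ch e, pa e}" for e
    by (auto simp: ch_def pa_def)
  have D: "dep (pa e) < dep (ch e)" if "e \<in> arcs ?G" for e
    using that neq unfolding arcs
    by (auto simp: ch_def pa_def up_def dep_def ends ix) (meson linorder_neqE_nat)+
  have "inj_on ch (arcs ?G)"
    unfolding inj_on_def arcs
    using uniq_Source uniq_Target neq
    by (auto simp: ch_def up_def ends ix inj split: if_splits) (metis linorder_neqE_nat)+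
  then have "\<not> undirected_cycle ?G vs es" for vs es
    using rooted_tree_no_cycle[of ?G ch pa dep] E D by blast
  moreover have "Digraph_Component.connected ?G"
  proof (rule rooted_tree_connected[of ?G ch pa dep "(Source, axis 1 1)"])
    show "tail ?G e \<in> verts ?G \<and> head ?G e \<in> verts ?G" if "e \<in> arcs ?G" for e
      using that by (auto simp: arcs verts ends)
    fix v assume v: "v \<in> verts ?G" "v \<noteq> (Source, axis 1 1)"
    then obtain x i where xi: "v = (x, axis i 1)" by (auto simp: verts)
    show "v \<in> ch ` arcs ?G"
    proof (cases x)
      case Source
      then have "i \<noteq> 1" using v(2) xi by auto
      then obtain a r where "m $ a $ r $ i \<noteq> 0" "d Target r < d Source i"
        using ex_Source by blast
      then show ?thesis
        by (intro image_eqI[of _ _ "(a, axis i 1, axis r 1)"])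
          (auto simp: arcs ch_def up_def ends ix xi Source)
    next
      case Target
      then obtain a c where "m $ a $ i $ c \<noteq> 0" "d Source c < d Target i"
        using ex_Target by blast
      then show ?thesis
        by (intro image_eqI[of _ _ "(a, axis c 1, axis i 1)"])
          (auto simp: arcs ch_def up_def ends ix xi Target)
    qed
  qed (use E D in \<open>auto simp: verts\<close>)
  ultimately show ?thesis
    using basis_of_rep_std_basis unfolding tree_rep_def underlying_tree_def by blast
qed

section \<open>Irreducible sets in the Zariski topology\<close>

definition polynomial_curve :: "('k::field \<Rightarrow> 'k) \<Rightarrow> bool" where
  "polynomial_curve f \<longleftrightarrow> (\<exists>p. f = poly p)"

lemma polynomial_curve_const [intro, simp]: "polynomial_curve (\<lambda>t. c)"
  unfolding polynomial_curve_def by (rule exI[of _ "[:c:]"]) auto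

lemma polynomial_curve_id [intro, simp]: "polynomial_curve (\<lambda>t. t)"
  unfolding polynomial_curve_def by (rule exI[of _ "[:0, 1:]"]) auto

lemma polynomial_curve_add [intro, simp]:
  "polynomial_curve f \<Longrightarrow> polynomial_curve g \<Longrightarrow> polynomial_curve (\<lambda>t. f t + g t)"
  unfolding polynomial_curve_def by (metis (no_types, lifting) ext poly_add)

lemma polynomial_curve_diff [intro, simp]:
  "polynomial_curve f \<Longrightarrow> polynomial_curve g \<Longrightarrow> polynomial_curve (\<lambda>t. f t - g t)"
  unfolding polynomial_curve_def by (metis (no_types, lifting) ext poly_diff)

lemma polynomial_curve_mult [intro, simp]:
  "polynomial_curve f \<Longrightarrow> polynomial_curve g \<Longrightarrow> polynomial_curve (\<lambda>t. f t * g t)"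
  unfolding polynomial_curve_def by (metis (no_types, lifting) ext poly_mult)

lemma polynomial_curve_sum [intro]:
  "(\<And>i. i \<in> I \<Longrightarrow> polynomial_curve (f i)) \<Longrightarrow> polynomial_curve (\<lambda>t. \<Sum>i\<in>I. f i t)"
  by (induction I rule: infinite_finite_induct) auto

lemma polynomial_curve_prod [intro]:
  "(\<And>i. i \<in> I \<Longrightarrow> polynomial_curve (f i)) \<Longrightarrow> polynomial_curve (\<lambda>t. \<Prod>i\<in>I. f i t)"
  by (induction I rule: infinite_finite_induct) auto

lemma polynomial_curve_finite_zeros:
  "polynomial_curve f \<Longrightarrow> f t\<^sub>0 \<noteq> 0 \<Longrightarrow> finite {t. f t = 0}"
  unfolding polynomial_curve_def using poly_roots_finite by (metis poly_0)

lemma polynomial_curve_det: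
  fixes A :: "'k::field \<Rightarrow> 'k^'n^'n"
  assumes "\<And>i j. polynomial_curve (\<lambda>t. A t $ i $ j)"
  shows "polynomial_curve (\<lambda>t. det (A t))"
  unfolding det_def using assms by (intro polynomial_curve_sum polynomial_curve_mult) auto

lemma polynomial_curve_compose:
  assumes "f \<in> polynomial_functions X" "\<And>x. x \<in> X \<Longrightarrow> polynomial_curve (\<lambda>t. x (\<gamma> t))"
  shows "polynomial_curve (\<lambda>t. f (\<gamma> t))"
  using assms by induction auto

text \<open>Over a finite field the product of all X - a, plus 1, is nonconstant and has no
  root.\<close>

lemma infinite_UNIV_alg_closed_field: "infinite (UNIV :: 'k::alg_closed_field set)"
proof
  assume fin: "finite (UNIV :: 'k set)"
  let ?q = "\<Prod>a::'k\<in>UNIV. [:-a, 1:]"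
  have "degree ?q = card (UNIV :: 'k set)"
    by (subst degree_prod_eq_sum_degree) (simp_all add: fin)
  moreover have "card (UNIV :: 'k set) > 0" using fin by (simp add: card_gt_0_iff)
  ultimately have "degree (?q + 1) > 0" by (subst degree_add_eq_left) auto
  then obtain x where "poly (?q + 1) x = 0" using alg_closed_imp_poly_has_root by blast
  then have "(\<Prod>a\<in>UNIV. x - a) + 1 = 0" by (simp add: poly_prod)
  moreover have "(\<Prod>a\<in>UNIV. x - a) = 0" using fin by (subst prod_zero_iff) auto
  ultimately show False by simp
qed

text \<open>The functions vanishing on \<open>P\<close> form a prime ideal of
  \<open>polynomial_functions X\<close>; \<open>P \<noteq> {}\<close> makes it proper. This form of
  irreducibility depends on the vanishing ideal only, so it passes directly to closures.\<close>

definition vanishing_prime :: "('p \<Rightarrow> 'k::field) set \<Rightarrow> 'p set \<Rightarrow> bool" where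
  "vanishing_prime X P \<longleftrightarrow> P \<noteq> {} \<and>
     (\<forall>f\<in>polynomial_functions X. \<forall>g\<in>polynomial_functions X.
        (\<forall>p\<in>P. f p * g p = 0) \<longrightarrow> (\<forall>p\<in>P. f p = 0) \<or> (\<forall>p\<in>P. g p = 0))"

lemma vanishing_primeD:
  assumes "vanishing_prime X P" "f \<in> polynomial_functions X" "g \<in> polynomial_functions X"
    and "\<And>p. p \<in> P \<Longrightarrow> f p * g p = 0"
  shows "(\<forall>p\<in>P. f p = 0) \<or> (\<forall>p\<in>P. g p = 0)"
  using assms unfolding vanishing_prime_def by simp

lemma irreducible_space_zariski:
  "irreducible_space (subtopology (zariski X) P) \<longleftrightarrow> vanishing_prime X P" (is "?L \<longleftrightarrow> ?R")
proof
  assume L: ?L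
  show ?R unfolding vanishing_prime_def
  proof (intro conjI ballI impI)
    show "P \<noteq> {}" using L by (simp add: irreducible_space_def)
    fix f g assume fg: "f \<in> polynomial_functions X" "g \<in> polynomial_functions X"
      and 0: "\<forall>p\<in>P. f p * g p = 0"
    have "closedin (zariski X) (zero_locus {f})" "closedin (zariski X) (zero_locus {g})"
      using fg by (auto simp: closedin_zariski)
    then have "closedin (subtopology (zariski X) P) (P \<inter> zero_locus {f})"
      "closedin (subtopology (zariski X) P) (P \<inter> zero_locus {g})"
      by (simp_all add: closedin_subtopology_Int_closed)
    moreover have "(P \<inter> zero_locus {f}) \<union> (P \<inter> zero_locus {g}) = P"
      using 0 by (auto simp: zero_locus_def)
    ultimately have "P \<inter> zero_locus {f} = P \<or> P \<inter> zero_locus {g} = P"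
      using L by (simp add: irreducible_space_def)
    then show "(\<forall>p\<in>P. f p = 0) \<or> (\<forall>p\<in>P. g p = 0)" by (auto simp: zero_locus_def)
  qed
next
  assume R: ?R
  show ?L unfolding irreducible_space_def
  proof (intro conjI allI impI)
    show "topspace (subtopology (zariski X) P) \<noteq> {}"
      using R by (simp add: vanishing_prime_def)
    fix C D assume CD: "closedin (subtopology (zariski X) P) C"
      "closedin (subtopology (zariski X) P) D" "C \<union> D = topspace (subtopology (zariski X) P)"
    obtain S T where S: "S \<subseteq> polynomial_functions X" "C = zero_locus S \<inter> P"
      and T: "T \<subseteq> polynomial_functions X" "D = zero_locus T \<inter> P"
      using CD(1,2) unfolding closedin_subtopology closedin_zariski by blast
    have "C = P \<or> D = P"
    proof (rule ccontr)
      assume "\<not> ?thesis"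
      then obtain f g where "f \<in> S" "\<exists>p\<in>P. f p \<noteq> 0" "g \<in> T" "\<exists>p\<in>P. g p \<noteq> 0"
        using S T by (auto simp: zero_locus_def)
      moreover from this have "\<forall>p\<in>P. f p * g p = 0"
        using CD(3) S T by (auto simp: zero_locus_def)
      ultimately show False using R S T unfolding vanishing_prime_def by blast
    qed
    then show "C = topspace (subtopology (zariski X) P) \<or> D = topspace (subtopology (zariski X) P)"
      by simp
  qed
qed

text \<open>
  Restricted to a curve through points where \<open>f\<close> and \<open>g\<close> do not vanish, the product \<open>f g\<close> is a
  nonzero polynomial in one variable, which has only finitely many zeros.
\<close>

lemma vanishing_prime_if_curves:
  fixes X :: "('p \<Rightarrow> 'k::alg_closed_field) set"
  assumes "P \<noteq> {}"
    and curve: "\<And>p q. p \<in> P \<Longrightarrow> q \<in> P \<Longrightarrow> \<exists>\<gamma>. \<gamma> 0 = p \<and> \<gamma> 1 = q \<and>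
      (\<forall>x\<in>X. polynomial_curve (\<lambda>t. x (\<gamma> t))) \<and> finite {t. \<gamma> t \<notin> P}"
  shows "vanishing_prime X P"
  unfolding vanishing_prime_def
proof (intro conjI ballI impI)
  fix f g assume fg: "f \<in> polynomial_functions X" "g \<in> polynomial_functions X"
    and 0: "\<forall>p\<in>P. f p * g p = 0"
  show "(\<forall>p\<in>P. f p = 0) \<or> (\<forall>p\<in>P. g p = 0)"
  proof (rule ccontr)
    assume "\<not> ?thesis"
    then obtain p q where pq: "p \<in> P" "f p \<noteq> 0" "q \<in> P" "g q \<noteq> 0" by blast
    obtain \<gamma> where \<gamma>: "\<gamma> 0 = p" "\<gamma> 1 = q" "\<And>x. x \<in> X \<Longrightarrow> polynomial_curve (\<lambda>t. x (\<gamma> t))"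
      and fin: "finite {t. \<gamma> t \<notin> P}"
      using curve[OF pq(1,3)] by blast
    have "finite {t. f (\<gamma> t) = 0}" "finite {t. g (\<gamma> t) = 0}"
      using polynomial_curve_finite_zeros[OF polynomial_curve_compose[OF fg(1) \<gamma>(3)], where t\<^sub>0 = 0]
        polynomial_curve_finite_zeros[OF polynomial_curve_compose[OF fg(2) \<gamma>(3)], where t\<^sub>0 = 1] pq \<gamma>
      by auto
    then have "finite ({t. f (\<gamma> t) = 0} \<union> {t. g (\<gamma> t) = 0} \<union> {t. \<gamma> t \<notin> P})" using fin by simp
    then have "{t. f (\<gamma> t) = 0} \<union> {t. g (\<gamma> t) = 0} \<union> {t. \<gamma> t \<notin> P} \<noteq> UNIV"
      using infinite_UNIV_alg_closed_field by metis
    then obtain t where "f (\<gamma> t) \<noteq> 0" "g (\<gamma> t) \<noteq> 0" "\<gamma> t \<in> P" by blast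
    then show False using 0 by auto
  qed
qed fact

text \<open>If \<open>C\<close> were in the closure of no piece, each piece would have a function
  vanishing on it but not on all of \<open>C\<close>. The product of these vanishes on
  \<open>U\<close>, while primality of \<open>C\<close> keeps it from vanishing on \<open>C\<close>.
  Hence \<open>C\<close> lies in the closure of one piece, which is irreducible, and maximality
  gives equality.\<close>

lemma irreducible_component_contains_piece:
  assumes C: "C \<in> irreducible_components_of (subtopology (zariski X) U)"
    and "finite \<P>" and U: "U = \<Union>\<P>" and prime: "\<And>P. P \<in> \<P> \<Longrightarrow> vanishing_prime X P"
  shows "\<exists>P\<in>\<P>. P \<subseteq> C"
proof -
  have irr: "irreducible_space (subtopology (subtopology (zariski X) U) D) \<longleftrightarrow> vanishing_prime X D"
    if "D \<subseteq> U" for D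
    using that by (simp add: subtopology_subtopology inf_absorb2 irreducible_space_zariski)
  have CU: "C \<subseteq> U" and Cp: "vanishing_prime X C"
    and max: "\<And>D. D \<subseteq> U \<Longrightarrow> vanishing_prime X D \<Longrightarrow> C \<subseteq> D \<Longrightarrow> C = D"
    using C irr by (auto simp: irreducible_components_of_def)
  \<comment> \<open>The closure of \<open>P\<close> within \<open>U\<close>; it has the same
    vanishing ideal as \<open>P\<close>.\<close>
  define cl where "cl P = {m\<in>U. \<forall>f\<in>polynomial_functions X. (\<forall>p\<in>P. f p = 0) \<longrightarrow> f m = 0}" for P
  have "\<exists>P\<in>\<P>. C \<subseteq> cl P"
  proof (rule ccontr)
    assume "\<not> ?thesis"
    then have "\<forall>P\<in>\<P>. \<exists>f\<in>polynomial_functions X. (\<forall>p\<in>P. f p = 0) \<and> (\<exists>m\<in>C. f m \<noteq> 0)"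
      using CU by (fastforce simp: cl_def)
    then obtain f where f: "\<And>P. P \<in> \<P> \<Longrightarrow> f P \<in> polynomial_functions X \<and> (\<forall>p\<in>P. f P p = 0) \<and>
        (\<exists>m\<in>C. f P m \<noteq> 0)" by metis
    have "(\<lambda>m. \<Prod>P\<in>\<Q>. f P m) \<in> polynomial_functions X \<and> (\<exists>m\<in>C. (\<Prod>P\<in>\<Q>. f P m) \<noteq> 0)"
      if "finite \<Q>" "\<Q> \<subseteq> \<P>" for \<Q>
      using that
    proof (induction \<Q>)
      case empty
      then show ?case using Cp by (auto simp: vanishing_prime_def intro: polynomial_functions.const)
    next
      case (insert P \<Q>)
      let ?g = "\<lambda>m. \<Prod>P\<in>\<Q>. f P m"
      have *: "f P \<in> polynomial_functions X" "\<exists>m\<in>C. f P m \<noteq> 0"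
        "?g \<in> polynomial_functions X" "\<exists>m\<in>C. ?g m \<noteq> 0"
        using insert f by auto
      have "\<exists>m\<in>C. f P m * ?g m \<noteq> 0"
        using vanishing_primeD[OF Cp *(1,3)] *(2,4) by blast
      then show ?case
        using insert.hyps polynomial_functions.mult[OF *(1,3)] by simp
    qed
    then obtain m where m: "m \<in> C" "(\<Prod>P\<in>\<P>. f P m) \<noteq> 0" using \<open>finite \<P>\<close> by blast
    moreover obtain P where "P \<in> \<P>" "m \<in> P" using m CU U by blast
    ultimately show False using f \<open>finite \<P>\<close> by (metis prod_zero_iff)
  qed
  then obtain P where P: "P \<in> \<P>" "C \<subseteq> cl P" by blast
  have sub: "P \<subseteq> cl P" using P U by (auto simp: cl_def)
  have eq: "(\<forall>p\<in>cl P. f p = 0) \<longleftrightarrow> (\<forall>p\<in>P. f p = 0)" if "f \<in> polynomial_functions X" for f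
    using that sub by (auto simp: cl_def)
  have "vanishing_prime X (cl P)"
    unfolding vanishing_prime_def
  proof (intro conjI ballI impI)
    show "cl P \<noteq> {}" using prime[OF P(1)] sub by (auto simp: vanishing_prime_def)
    fix f g assume fg: "f \<in> polynomial_functions X" "g \<in> polynomial_functions X"
      and "\<forall>p\<in>cl P. f p * g p = 0"
    then have "(\<forall>p\<in>P. f p = 0) \<or> (\<forall>p\<in>P. g p = 0)"
      using vanishing_primeD[OF prime[OF P(1)] fg] sub by blast
    then show "(\<forall>p\<in>cl P. f p = 0) \<or> (\<forall>p\<in>cl P. g p = 0)" using eq fg by blast
  qed
  then have "C = cl P" using max P by (auto simp: cl_def)
  then show ?thesis using sub P by blast
qed

section \<open>Generic constancy of kernels\<close>

lemma generalized_inverse_exists: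
  fixes A :: "'k::field^'n^'m"
  shows "\<exists>B :: 'k^'m^'n. A ** B ** A = A"
proof -
  obtain g where g: "Vector_Spaces.linear (*s) (*s) g" "\<And>v. A *v g (A *v v) = A *v v"
    using vec.linear_exists_right_inverse_on[OF matrix_vector_mul_linear_gen vec.subspace_UNIV, of A]
    by auto
  then have "A ** matrix g ** A = A"
    by (simp add: matrix_eq matrix_works flip: matrix_vector_mul_assoc)
  then show ?thesis ..
qed

text \<open>Semicontinuity of rank: by \<open>ker\<close> the kernel at \<open>t\<^sub>0\<close>
  lies in all the others, and a kernel can be larger only where the rank drops. One determinant,
  polynomial in \<open>t\<close> and nonzero at \<open>t\<^sub>0\<close>, controls these
  exceptions.\<close>

lemma kernel_generically_constant:
  fixes A :: "'k::field \<Rightarrow> 'k^'n^'m"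
  assumes poly: "\<And>i j. polynomial_curve (\<lambda>t. A t $ i $ j)"
    and ker: "\<And>t w. A t\<^sub>0 *v w = 0 \<Longrightarrow> A t *v w = 0"
  shows "finite {t. \<exists>w. A t *v w = 0 \<and> A t\<^sub>0 *v w \<noteq> 0}"
proof -
  obtain B where B: "A t\<^sub>0 ** B ** A t\<^sub>0 = A t\<^sub>0" using generalized_inverse_exists by blast
  \<comment> \<open>\<open>D t\<^sub>0\<close> is the identity, and where \<open>D t\<close> is invertible, the kernels of \<open>A t\<close> and \<open>A t\<^sub>0\<close> agree.\<close>
  define D where "D t = B ** A t + (mat 1 - B ** A t\<^sub>0)" for t
  have "polynomial_curve (\<lambda>t. det (D t))"
    unfolding D_def using poly
    by (auto simp: matrix_matrix_mult_def intro!: polynomial_curve_det polynomial_curve_add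
        polynomial_curve_diff polynomial_curve_sum polynomial_curve_mult)
  moreover have "det (D t\<^sub>0) \<noteq> 0" by (simp add: D_def)
  ultimately have "finite {t. det (D t) = 0}" by (rule polynomial_curve_finite_zeros)
  moreover have "A t\<^sub>0 *v w = 0" if "det (D t) \<noteq> 0" "A t *v w = 0" for t w
  proof -
    \<comment> \<open>\<open>B ** A t\<^sub>0\<close> is idempotent with the same kernel as
      \<open>A t\<^sub>0\<close>. So \<open>w - u\<close> lies in that kernel, and it remains to see
      that \<open>D t\<close> annihilates \<open>u\<close>.\<close>
    define u where "u = B *v (A t\<^sub>0 *v w)"
    have "A t\<^sub>0 *v u = A t\<^sub>0 *v w"
      using B by (simp add: u_def matrix_vector_mul_assoc matrix_mul_assoc)
    then have 1: "A t\<^sub>0 *v (w - u) = 0" by (simp add: matrix_vector_mult_diff_distrib)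
    then have "A t *v u = 0"
      using ker[OF 1, of t] that(2) by (simp add: matrix_vector_mult_diff_distrib)
    then have "D t *v u = u - B *v (A t\<^sub>0 *v u)"
      by (simp add: D_def matrix_vector_mult_add_rdistrib matrix_vector_mult_diff_rdistrib
          flip: matrix_vector_mul_assoc)
    also have "\<dots> = 0" using \<open>A t\<^sub>0 *v u = A t\<^sub>0 *v w\<close> by (simp add: u_def)
    finally have "u = 0"
      using that(1) by (metis invertible_det_nz invertible_def matrix_left_invertible_ker)
    then show ?thesis using 1 by simp
  qed
  then have "{t. \<exists>w. A t *v w = 0 \<and> A t\<^sub>0 *v w \<noteq> 0} \<subseteq> {t. det (D t) = 0}" by blast
  ultimately show ?thesis by (rule finite_subset[rotated])
qed

section \<open>Triples with local endomorphism algebra\<close>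

text \<open>All six algebras consist of such matrices: \<open>low 0 0 1 0\<close> is the corner unit
  E31, \<open>low 0 1 0 1\<close> the nilpotent Jordan block.\<close>

definition low :: "'k::field \<Rightarrow> 'k \<Rightarrow> 'k \<Rightarrow> 'k \<Rightarrow> 'k^3^3" where
  "low s p q r = vector [vector [s, 0, 0], vector [p, s, 0], vector [q, r, s]]"

lemma low_nth [simp]:
  "low s p q r $ 1 $ 1 = s" "low s p q r $ 1 $ 2 = 0" "low s p q r $ 1 $ 3 = 0"
  "low s p q r $ 2 $ 1 = p" "low s p q r $ 2 $ 2 = s" "low s p q r $ 2 $ 3 = 0"
  "low s p q r $ 3 $ 1 = q" "low s p q r $ 3 $ 2 = r" "low s p q r $ 3 $ 3 = s"
  by (simp_all add: low_def vector_3)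

lemma mat_3_nth [simp]:
  "(mat s :: 'k::zero^3^3) $ 1 $ 1 = s" "(mat s :: 'k^3^3) $ 1 $ 2 = 0" "(mat s :: 'k^3^3) $ 1 $ 3 = 0"
  "(mat s :: 'k^3^3) $ 2 $ 1 = 0" "(mat s :: 'k^3^3) $ 2 $ 2 = s" "(mat s :: 'k^3^3) $ 2 $ 3 = 0"
  "(mat s :: 'k^3^3) $ 3 $ 1 = 0" "(mat s :: 'k^3^3) $ 3 $ 2 = 0" "(mat s :: 'k^3^3) $ 3 $ 3 = s"
  by (simp_all add: mat_def)

lemma mat3_eq_iff:
  fixes A B :: "'k^3^3"
  shows "A = B \<longleftrightarrow>
    A $ 1 $ 1 = B $ 1 $ 1 \<and> A $ 1 $ 2 = B $ 1 $ 2 \<and> A $ 1 $ 3 = B $ 1 $ 3 \<and>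
    A $ 2 $ 1 = B $ 2 $ 1 \<and> A $ 2 $ 2 = B $ 2 $ 2 \<and> A $ 2 $ 3 = B $ 2 $ 3 \<and>
    A $ 3 $ 1 = B $ 3 $ 1 \<and> A $ 3 $ 2 = B $ 3 $ 2 \<and> A $ 3 $ 3 = B $ 3 $ 3"
  by (auto simp: vec_eq_iff forall_3)

lemma mult3_nth:
  fixes A B :: "'k::semiring_1^3^3"
  shows "(A ** B) $ r $ c = A $ r $ 1 * B $ 1 $ c + A $ r $ 2 * B $ 2 $ c + A $ r $ 3 * B $ 3 $ c"
  by (simp add: matrix_matrix_mult_def sum_3)

lemma matrix_add_rdistrib: "(B + C) ** A = B ** A + C ** A"
  by (simp add: vec_eq_iff matrix_matrix_mult_def distrib_right sum.distrib)

lemma intertwiners_add: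
  "(F, G) \<in> intertwiners m \<Longrightarrow> (F', G') \<in> intertwiners m \<Longrightarrow> (F + F', G + G') \<in> intertwiners m"
  by (simp add: intertwiners_def matrix_add_ldistrib matrix_add_rdistrib)

lemma intertwiners_mult:
  assumes "(F, G) \<in> intertwiners m" "(F', G') \<in> intertwiners m"
  shows "(F ** F', G ** G') \<in> intertwiners m"
proof -
  have "G ** G' ** m $ a = m $ a ** (F ** F')" for a
    using assms by (simp add: intertwiners_def flip: matrix_mul_assoc) (simp add: matrix_mul_assoc)
  then show ?thesis by (simp add: intertwiners_def)
qed

lemma intertwiners_mat: "(mat s, mat s) \<in> intertwiners m"
  by (simp add: intertwiners_def mat3_eq_iff mult3_nth)

lemma intertwiners_diff:
  assumes "(F, G) \<in> intertwiners m" "(F', G') \<in> intertwiners m"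
  shows "(F - F', G - G') \<in> intertwiners m"
proof -
  have "(mat (-1) ** F', mat (-1) ** G') \<in> intertwiners m"
    using assms(2) intertwiners_mat by (rule intertwiners_mult[rotated])
  moreover have "mat (-1) ** X = - X" for X :: "'a^3^3"
    by (simp add: mat3_eq_iff mult3_nth)
  ultimately show ?thesis using intertwiners_add[OF assms(1)] by force
qed

text \<open>A nonzero finite-dimensional algebra is local if and only if 0 and 1 are its only
  idempotents.\<close>

definition local_triple :: "'k::field^3^3^3 \<Rightarrow> bool" where
  "local_triple m \<longleftrightarrow> (\<forall>(F, G)\<in>intertwiners m. F ** F = F \<longrightarrow> G ** G = G \<longrightarrow>
     (F, G) = (0, 0) \<or> (F, G) = (mat 1, mat 1))"

lemma local_tripleD:
  assumes "local_triple m" "(F, G) \<in> intertwiners m" "F ** F = F" "G ** G = G"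
  shows "F = 0 \<and> G = 0 \<or> F = mat 1 \<and> G = mat 1"
  using assms unfolding local_triple_def by fast

section \<open>Fitting idempotents and nilpotent endomorphisms\<close>

lemma cayley_hamilton_3:
  fixes H :: "'k::field^3^3"
  obtains s t where "H ** H ** H = mat t ** (H ** H) - mat s ** H + mat (det H)"
proof
  let ?t = "H $ 1 $ 1 + H $ 2 $ 2 + H $ 3 $ 3"
  let ?s = "H $ 1 $ 1 * H $ 2 $ 2 - H $ 1 $ 2 * H $ 2 $ 1 + H $ 1 $ 1 * H $ 3 $ 3
    - H $ 1 $ 3 * H $ 3 $ 1 + H $ 2 $ 2 * H $ 3 $ 3 - H $ 2 $ 3 * H $ 3 $ 2"
  show "H ** H ** H = mat ?t ** (H ** H) - mat ?s ** H + mat (det H)"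
    unfolding mat3_eq_iff mult3_nth vector_add_component vector_minus_component mat_3_nth det_3
    by (intro conjI) algebra+
qed

text \<open>On \<open>k^3\<close> the powers of \<open>H\<close> stabilise at the third one. The
  factor \<open>X\<close> is found by solving the characteristic equation from its lowest nonzero
  coefficient: \<open>det H\<close>, \<open>s\<close> or \<open>t\<close>; if all three vanish,
  \<open>H\<close> is nilpotent and \<open>X = 0\<close> serves.\<close>

lemma cube_eq_fourth_power_mult:
  fixes H :: "'k::field^3^3"
  shows "\<exists>X. X ** H = H ** X \<and> H ** H ** H = H ** H ** H ** H ** X"
proof -
  obtain s t where CH: "H ** H ** H = mat t ** (H ** H) - mat s ** H + mat (det H)"
    by (rule cayley_hamilton_3)
  have sc: "mat c ** A = A ** mat c" for c and A :: "'k^3^3"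
    by (simp add: mat3_eq_iff mult3_nth)
  have inv: "mat (inverse c) ** mat c = (mat 1 :: 'k^3^3)" if "c \<noteq> 0" for c :: 'k
    using that unfolding mat3_eq_iff mult3_nth by simp
  consider "det H \<noteq> 0" | "det H = 0" "s \<noteq> 0" | "det H = 0" "s = 0" "t \<noteq> 0"
    | "det H = 0" "s = 0" "t = 0" by blast
  then show ?thesis
  proof cases
    case 1
    then obtain X where "H ** X = mat 1" "X ** H = mat 1"
      using invertible_det_nz[of H] by (auto simp: invertible_def)
    then show ?thesis by (intro exI[of _ X]) (simp flip: matrix_mul_assoc)
  next
    case 2
    define X where "X = mat (inverse s) ** (mat t - H)"
    have comm: "X ** H = H ** X"
      unfolding X_def by (simp add: mat3_eq_iff mult3_nth) (simp add: algebra_simps)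
    have "mat s ** H = mat t ** (H ** H) - H ** H ** H"
      using CH 2 by (simp add: mat3_eq_iff)
    also have "\<dots> = H ** H ** (mat t - H)"
      by (simp add: sc matrix_mul_assoc mat3_eq_iff) (simp add: mult3_nth algebra_simps)
    finally have "mat (inverse s) ** (mat s ** H) = H ** H ** X"
      unfolding X_def by (metis sc matrix_mul_assoc)
    then have "H = H ** H ** X" using inv[OF 2(2)] by (simp add: matrix_mul_assoc)
    then have "H ** H ** H = H ** H ** (H ** H ** X)" by simp
    then show ?thesis using comm by (auto simp: matrix_mul_assoc)
  next
    case 3
    define X :: "'k^3^3" where "X = mat (inverse t)"
    have "H ** H ** H = mat t ** (H ** H)"
      using CH 3 by (simp add: mat3_eq_iff mult3_nth)
    then have "H ** H = X ** (H ** H ** H)"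
      using inv[OF 3(3)] by (simp add: X_def matrix_mul_assoc)
    then have "H ** H ** H = H ** H ** H ** H ** X"
      by (metis X_def sc matrix_mul_assoc)
    then show ?thesis using sc X_def by metis
  next
    case 4
    then have "H ** H ** H = 0" using CH by (simp add: mat3_eq_iff mult3_nth)
    then show ?thesis by (intro exI[of _ 0]) simp
  qed
qed

text \<open>\<open>e\<close> is the projection onto the image of the cube of \<open>H\<close> along
  its kernel. Factorisations of \<open>e\<close> through the cube on both sides are provided because
  intertwining has to be transferred from the cubes to the idempotents.\<close>

lemma fitting_idempotent:
  fixes H :: "'k::field^3^3"
  obtains e Z where "e ** e = e" "e = H ** H ** H ** Z" "e = Z ** (H ** H ** H)"
    "H ** H ** H ** e = H ** H ** H" "e ** (H ** H ** H) = H ** H ** H"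
proof -
  obtain X where X: "X ** H = H ** X" "H ** H ** H = H ** H ** H ** H ** X"
    using cube_eq_fourth_power_mult by blast
  define C Z where "C = H ** H ** H" and "Z = X ** X ** X"
  have C1: "C = H ** C ** X" using X(2) by (simp add: C_def matrix_mul_assoc)
  \<comment> \<open>Substituting \<open>C1\<close> into itself collects three factors
    \<open>H\<close> on the left, which make up \<open>C\<close>, and three factors \<open>X\<close>
    on the right, which make up \<open>Z\<close>.\<close>
  have "C = H ** (H ** (H ** C ** X) ** X) ** X" using C1 by metis
  then have CCZ: "C = C ** C ** Z" by (simp add: C_def Z_def matrix_mul_assoc)
  have XC: "X ** C = C ** X" unfolding C_def using X(1) by (metis matrix_mul_assoc)
  then have comm: "Z ** C = C ** Z" unfolding Z_def by (metis matrix_mul_assoc)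
  show thesis
  proof (rule that[of "C ** Z" Z])
    show "C ** Z ** (C ** Z) = C ** Z"
      using comm CCZ by (metis matrix_mul_assoc)
    show "H ** H ** H ** (C ** Z) = H ** H ** H"
      using CCZ by (simp add: matrix_mul_assoc flip: C_def)
    show "C ** Z ** (H ** H ** H) = H ** H ** H"
      using CCZ comm by (metis C_def matrix_mul_assoc)
  qed (use comm C_def in auto)
qed

lemma eigenvalue_exists:
  fixes F :: "'k::alg_closed_field^3^3"
  shows "\<exists>s. det (F - mat s) = 0"
proof -
  let ?t = "F $ 1 $ 1 + F $ 2 $ 2 + F $ 3 $ 3"
  let ?s = "F $ 1 $ 1 * F $ 2 $ 2 - F $ 1 $ 2 * F $ 2 $ 1 + F $ 1 $ 1 * F $ 3 $ 3
    - F $ 1 $ 3 * F $ 3 $ 1 + F $ 2 $ 2 * F $ 3 $ 3 - F $ 2 $ 3 * F $ 3 $ 2"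
  \<comment> \<open>These are the coefficients of det (F - x) as a polynomial in x.\<close>
  have "degree [:det F, - ?s, ?t, -1:] > 0" by simp
  then obtain x where "poly [:det F, - ?s, ?t, -1:] x = 0"
    using alg_closed_imp_poly_has_root by blast
  then have "det (F - mat x) = 0" by (simp add: det_3 algebra_simps)
  then show ?thesis ..
qed

text \<open>The scalar is an eigenvalue of \<open>F\<close> alone. The Fitting idempotents of
  \<open>F - s\<close> and \<open>G - s\<close> form an idempotent endomorphism, which by locality
  is 0 or 1; it is not 1 because \<open>F - s\<close> is singular. So both cubes vanish, and the
  same scalar serves \<open>G\<close>.\<close>

lemma local_triple_nilpotent:
  fixes m :: "'k::alg_closed_field^3^3^3"
  assumes m: "local_triple m" "(F, G) \<in> intertwiners m"
  obtains s where "(F - mat s) ** (F - mat s) ** (F - mat s) = 0"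
    "(G - mat s) ** (G - mat s) ** (G - mat s) = 0"
proof -
  obtain s where s: "det (F - mat s) = 0" using eigenvalue_exists by blast
  define H K where "H = F - mat s" and "K = G - mat s"
  have HK: "(H, K) \<in> intertwiners m"
    unfolding H_def K_def using m(2) intertwiners_mat by (rule intertwiners_diff)
  define H3 K3 where "H3 = H ** H ** H" and "K3 = K ** K ** K"
  have HK3: "K3 ** m $ a = m $ a ** H3" for a
    using intertwiners_mult[OF intertwiners_mult[OF HK HK] HK]
    by (simp add: intertwiners_def H3_def K3_def)
  obtain e Z where e: "e ** e = e" "e = H3 ** Z" "e = Z ** H3" "H3 ** e = H3" "e ** H3 = H3"
    unfolding H3_def by (rule fitting_idempotent)
  obtain f Y where f: "f ** f = f" "f = K3 ** Y" "f = Y ** K3" "K3 ** f = K3" "f ** K3 = K3"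
    unfolding K3_def by (rule fitting_idempotent)
  \<comment> \<open>Both sides equal \<open>f ** m $ a ** e\<close>: the left one since
    \<open>f\<close> factors as \<open>Y ** K3\<close> and \<open>H3\<close> absorbs
    \<open>e\<close>, the right one since \<open>e\<close> factors as \<open>H3 ** Z\<close> and
    \<open>K3\<close> absorbs \<open>f\<close>.\<close>
  have "f ** m $ a = m $ a ** e" for a
  proof -
    have "f ** m $ a = Y ** (m $ a ** H3)" by (subst f(3)) (simp add: HK3 flip: matrix_mul_assoc)
    also have "\<dots> = Y ** (m $ a ** H3) ** e" by (simp add: e(4) flip: matrix_mul_assoc)
    also have "\<dots> = f ** m $ a ** e" by (subst f(3)) (simp add: HK3 flip: matrix_mul_assoc)
    also have "\<dots> = f ** (m $ a ** H3) ** Z" by (subst e(2)) (simp flip: matrix_mul_assoc)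
    also have "\<dots> = (m $ a ** H3) ** Z" by (simp add: f(5) matrix_mul_assoc flip: HK3)
    also have "\<dots> = m $ a ** e" by (subst e(2)) (simp flip: matrix_mul_assoc)
    finally show ?thesis .
  qed
  then have "(e, f) \<in> intertwiners m" by (simp add: intertwiners_def)
  then have "e = 0 \<and> f = 0 \<or> e = mat 1 \<and> f = mat 1"
    using local_tripleD[OF m(1)] e(1) f(1) by blast
  moreover have "e \<noteq> mat 1"
  proof
    assume "e = mat 1"
    then have "H ** (H ** H ** Z) = mat 1" using e(2) by (simp add: H3_def matrix_mul_assoc)
    then have "det H * det (H ** H ** Z) = 1" by (metis det_I det_mul)
    then show False using s by (simp add: H_def)
  qed
  ultimately have "H3 = 0" "K3 = 0" using e f by auto
  then show thesis using that[of s] by (simp add: H_def K_def H3_def K3_def)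
qed

text \<open>A nonzero column of \<open>F\<close>, scaled and put at the position that makes a
  diagonal entry 1, is a rank-one idempotent \<open>P\<close>. Its image lies in that of
  \<open>F\<close>, so every arrow kills it and \<open>(P, 0)\<close> is a forbidden
  idempotent.\<close>

lemma local_triple_Source_eq_0:
  assumes m: "local_triple m" "(F, 0) \<in> intertwiners m"
  shows "F = 0"
proof (rule ccontr)
  assume "F \<noteq> 0"
  then obtain i j where ij: "F $ i $ j \<noteq> 0" by (auto simp: vec_eq_iff)
  define P where "P = (\<chi> r c. if c = i then F $ r $ j / F $ i $ j else 0)"
  have "(m $ a ** F) $ r $ j = 0" for a r
    using m(2) by (simp add: intertwiners_def)
  then have "(\<Sum>k\<in>UNIV. m $ a $ r $ k * F $ k $ j) / F $ i $ j = 0" for a r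
    by (simp add: matrix_matrix_mult_def)
  then have "(m $ a ** P) $ r $ c = 0" for a r c
    by (cases "c = i") (simp_all add: matrix_matrix_mult_def P_def sum_divide_distrib)
  then have "m $ a ** P = 0" for a by (simp add: vec_eq_iff)
  then have "(P, 0) \<in> intertwiners m" by (simp add: intertwiners_def)
  moreover have "P ** P = P"
  proof -
    have "(P ** P) $ r $ c = (\<Sum>k\<in>UNIV. if k = i then P $ r $ i * P $ i $ c else 0)" for r c
      unfolding matrix_matrix_mult_def vec_lambda_beta by (rule sum.cong) (auto simp: P_def)
    then have "(P ** P) $ r $ c = P $ r $ c" for r c using ij by (simp add: P_def)
    then show ?thesis by (simp add: vec_eq_iff)
  qed
  ultimately have "P = 0 \<or> (0 :: 'a^3^3) = mat 1" using local_tripleD[OF m(1)] by fastforce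
  moreover have "P $ i $ i = 1" using ij by (simp add: P_def)
  then have "P \<noteq> 0" by auto
  moreover have "(0 :: 'a^3^3) \<noteq> mat 1" by (simp add: mat3_eq_iff)
  ultimately show False by blast
qed

text \<open>The transposed argument: a scaled row of \<open>G\<close>, put at row \<open>j\<close>,
  is a rank-one idempotent annihilating all arrows from the left.\<close>

lemma local_triple_Target_eq_0:
  assumes m: "local_triple m" "(0, G) \<in> intertwiners m"
  shows "G = 0"
proof (rule ccontr)
  assume "G \<noteq> 0"
  then obtain i j where ij: "G $ i $ j \<noteq> 0" by (auto simp: vec_eq_iff)
  define P where "P = (\<chi> r c. if r = j then G $ i $ c / G $ i $ j else 0)"
  have "(G ** m $ a) $ i $ c = 0" for a c
    using m(2) by (simp add: intertwiners_def)
  then have "(\<Sum>k\<in>UNIV. G $ i $ k * m $ a $ k $ c) / G $ i $ j = 0" for a c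
    by (simp add: matrix_matrix_mult_def)
  then have "(P ** m $ a) $ r $ c = 0" for a r c
    by (cases "r = j") (simp_all add: matrix_matrix_mult_def P_def sum_divide_distrib)
  then have "P ** m $ a = 0" for a by (simp add: vec_eq_iff)
  then have "(0, P) \<in> intertwiners m" by (simp add: intertwiners_def)
  moreover have "P ** P = P"
  proof -
    have "(P ** P) $ r $ c = (\<Sum>k\<in>UNIV. if k = j then P $ r $ j * P $ j $ c else 0)" for r c
      unfolding matrix_matrix_mult_def vec_lambda_beta by (rule sum.cong) (auto simp: P_def)
    then have "(P ** P) $ r $ c = P $ r $ c" for r c using ij by (simp add: P_def)
    then show ?thesis by (simp add: vec_eq_iff)
  qed
  ultimately have "P = 0 \<or> (0 :: 'a^3^3) = mat 1" using local_tripleD[OF m(1)] by fastforce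
  moreover have "P $ j $ j = 1" using ij by (simp add: P_def)
  then have "P \<noteq> 0" by auto
  moreover have "(0 :: 'a^3^3) \<noteq> mat 1" by (simp add: mat3_eq_iff)
  ultimately show False by blast
qed

lemma indecomposable_iff_local_triple:
  "indecomposable_rep kronecker3 (rep m) \<longleftrightarrow> local_triple m"
  by (simp add: indecomposable_rep_kronecker3 local_triple_def)

lemma local_triple_Target_unique:
  assumes "local_triple m" "(F, G) \<in> intertwiners m" "(F, G') \<in> intertwiners m"
  shows "G = G'"
  using local_triple_Target_eq_0[OF assms(1), of "G - G'"] intertwiners_diff[OF assms(2,3)] by simp

lemma local_triple_Source_unique:
  assumes "local_triple m" "(F, G) \<in> intertwiners m" "(F', G) \<in> intertwiners m"
  shows "F = F'"
  using local_triple_Source_eq_0[OF assms(1), of "F - F'"] intertwiners_diff[OF assms(2,3)] by simp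

text \<open>Isomorphism of \<open>rep m\<close> with \<open>rep v\<close>, given by \<open>B\<close>
  at the source and the inverse of \<open>A\<close> at the target.\<close>

definition equivalent_triples :: "'k::field^3^3^3 \<Rightarrow> 'k^3^3^3 \<Rightarrow> bool" where
  "equivalent_triples m v \<longleftrightarrow>
     (\<exists>A B. invertible A \<and> invertible B \<and> (\<forall>a. m $ a = A ** v $ a ** B))"

lemma equivalent_triplesI:
  assumes "A ** A' = mat 1" "A' ** A = mat 1" "B ** B' = mat 1" "B' ** B = mat 1"
    and "\<And>a. m $ a = A ** v $ a ** B"
  shows "equivalent_triples m v"
  using assms unfolding equivalent_triples_def invertible_def by blast

lemma equivalent_triplesE:
  assumes "equivalent_triples m v"
  obtains A A' B B' where "A ** A' = mat 1" "A' ** A = mat 1" "B ** B' = mat 1" "B' ** B = mat 1"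
    and "\<forall>a. m $ a = A ** v $ a ** B"
proof -
  obtain A B where "invertible A" "invertible B" and m: "\<And>a. m $ a = A ** v $ a ** B"
    using assms by (auto simp: equivalent_triples_def)
  then obtain A' B' where "A ** A' = mat 1" "A' ** A = mat 1" "B ** B' = mat 1" "B' ** B = mat 1"
    by (auto simp: invertible_def)
  then show thesis using that m by simp
qed

lemma equivalent_triples_refl: "equivalent_triples m m"
  by (rule equivalent_triplesI[of "mat 1" "mat 1" "mat 1" "mat 1"]) simp_all

lemma equivalent_triples_sym:
  assumes "equivalent_triples m v"
  shows "equivalent_triples v m"
proof -
  obtain A A' B B' where 1: "A ** A' = mat 1" "A' ** A = mat 1" "B ** B' = mat 1" "B' ** B = mat 1"
    and 2: "\<forall>a. m $ a = A ** v $ a ** B" using assms by (rule equivalent_triplesE)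
  show ?thesis
    by (rule equivalent_triplesI[OF 1(2,1,4,3)]) (rule conj_sym[OF 1(2,3) 2[rule_format]])
qed

lemma equivalent_triples_trans:
  assumes "equivalent_triples m v" "equivalent_triples v w"
  shows "equivalent_triples m w"
proof -
  obtain A B where 1: "invertible A" "invertible B" "\<And>a. m $ a = A ** v $ a ** B"
    using assms(1) by (auto simp: equivalent_triples_def)
  obtain C D where 2: "invertible C" "invertible D" "\<And>a. v $ a = C ** w $ a ** D"
    using assms(2) by (auto simp: equivalent_triples_def)
  have "m $ a = (A ** C) ** w $ a ** (D ** B)" for a
    using 1(3) 2(3) by (simp add: matrix_mul_assoc)
  then show ?thesis using 1 2 invertible_mult unfolding equivalent_triples_def by blast
qed

lemma conj_mult:
  fixes X X' P :: "'k::field^3^3"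
  assumes "X ** X' = mat 1"
  shows "(X' ** P ** X) ** (X' ** R ** X) = X' ** (P ** R) ** X"
proof -
  have "(X' ** P ** X) ** (X' ** R ** X) = X' ** P ** (X ** X') ** R ** X"
    by (simp only: matrix_mul_assoc)
  then show ?thesis by (simp add: assms matrix_mul_assoc)
qed

lemma conj_eq_0_iff:
  fixes X X' P :: "'k::field^3^3"
  assumes "X ** X' = mat 1"
  shows "X' ** P ** X = 0 \<longleftrightarrow> P = 0"
  using conj_sym[of X X' X X' "X' ** P ** X" P] assms matrix_left_right_inverse[of X X'] by auto

lemma conj_eq_1_iff:
  fixes X X' P :: "'k::field^3^3"
  assumes "X ** X' = mat 1"
  shows "X' ** P ** X = mat 1 \<longleftrightarrow> P = mat 1"
  using conj_sym[of X X' X X' "X' ** P ** X" P] assms matrix_left_right_inverse[of X X'] by auto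

lemma local_triple_equivalent:
  assumes "equivalent_triples m v" "local_triple m"
  shows "local_triple v"
  unfolding local_triple_def
proof (intro ballI, clarify)
  fix F G assume FG: "(F, G) \<in> intertwiners v" "F ** F = F" "G ** G = G"
    and ne: "\<not> (F = mat 1 \<and> G = mat 1)"
  obtain A A' B B' where 1: "A ** A' = mat 1" "A' ** A = mat 1" "B ** B' = mat 1" "B' ** B = mat 1"
    and 2: "\<forall>a. m $ a = A ** v $ a ** B" using assms(1) by (rule equivalent_triplesE)
  have "(B' ** F ** B, A ** G ** A') \<in> intertwiners m"
    by (rule intertwiners_conj[OF 1(2,3) 2[rule_format] FG(1)])
  moreover have "(B' ** F ** B) ** (B' ** F ** B) = B' ** F ** B"
    "(A ** G ** A') ** (A ** G ** A') = A ** G ** A'"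
    using FG by (simp_all add: conj_mult 1)
  ultimately have "B' ** F ** B = 0 \<and> A ** G ** A' = 0 \<or>
      B' ** F ** B = mat 1 \<and> A ** G ** A' = mat 1"
    using local_tripleD[OF assms(2)] by blast
  then show "F = 0 \<and> G = 0"
    using ne by (simp add: conj_eq_0_iff conj_eq_1_iff 1)
qed

section \<open>Irreducibility of the pieces\<close>

definition segment_mat :: "'k::field^'n^'m \<Rightarrow> 'k^'n^'m \<Rightarrow> 'k \<Rightarrow> 'k^'n^'m" where
  "segment_mat A B t = (\<chi> r c. A $ r $ c + t * (B $ r $ c - A $ r $ c))"

lemma segment_mat_0 [simp]: "segment_mat A B 0 = A"
  and segment_mat_1 [simp]: "segment_mat A B 1 = B"
  by (simp_all add: segment_mat_def)

lemma polynomial_curve_segment_mat: "polynomial_curve (\<lambda>t. segment_mat A B t $ r $ c)"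
  by (simp add: segment_mat_def)

definition segment_triple :: "'k::field^3^3^3 \<Rightarrow> 'k^3^3^3 \<Rightarrow> 'k \<Rightarrow> 'k^3^3^3" where
  "segment_triple u v t = (\<chi> a. segment_mat (u $ a) (v $ a) t)"

lemma segment_triple_0 [simp]: "segment_triple u v 0 = u"
  and segment_triple_1 [simp]: "segment_triple u v 1 = v"
  by (simp_all add: segment_triple_def)

lemma segment_mat_intertwines:
  assumes "G ** A = A ** F" "G ** B = B ** F"
  shows "G ** segment_mat A B t = segment_mat A B t ** F"
proof -
  have "(\<Sum>k\<in>UNIV. G $ r $ k * A $ k $ c) = (\<Sum>k\<in>UNIV. A $ r $ k * F $ k $ c)"
    "(\<Sum>k\<in>UNIV. G $ r $ k * B $ k $ c) = (\<Sum>k\<in>UNIV. B $ r $ k * F $ k $ c)" for r c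
    using assms by (simp_all add: matrix_matrix_mult_def vec_eq_iff)
  moreover have "(\<Sum>k\<in>UNIV. G $ r $ k * (A $ k $ c + t * (B $ k $ c - A $ k $ c))) =
      (\<Sum>k\<in>UNIV. G $ r $ k * A $ k $ c) +
      t * ((\<Sum>k\<in>UNIV. G $ r $ k * B $ k $ c) - (\<Sum>k\<in>UNIV. G $ r $ k * A $ k $ c))" for r c
    by (simp add: algebra_simps sum.distrib sum_subtractf sum_distrib_left)
  moreover have "(\<Sum>k\<in>UNIV. (A $ r $ k + t * (B $ r $ k - A $ r $ k)) * F $ k $ c) =
      (\<Sum>k\<in>UNIV. A $ r $ k * F $ k $ c) +
      t * ((\<Sum>k\<in>UNIV. B $ r $ k * F $ k $ c) - (\<Sum>k\<in>UNIV. A $ r $ k * F $ k $ c))" for r c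
    by (simp add: algebra_simps sum.distrib sum_subtractf sum_distrib_left)
  ultimately show ?thesis
    by (simp add: segment_mat_def matrix_matrix_mult_def vec_eq_iff)
qed

text \<open>For a fixed triple, intertwining is a linear condition on the 18 entries of a pair, so
  \<open>intertwiners\<close> is the kernel of a 27 by 18 matrix that is linear in the triple. Along
  the segment all kernels contain the common kernel of the end points, and only finitely many are
  larger.\<close>

lemma intertwiners_generically_constant:
  fixes u v :: "'k::field^3^3^3"
  assumes "intertwiners u = intertwiners v"
  shows "finite {t. intertwiners (segment_triple u v t) \<noteq> intertwiners u}"
proof -
  \<comment> \<open>A pair is coded by one vector: the index \<open>False\<close> marks the entries
    of the source matrix, \<open>True\<close> those of the target matrix.\<close>
  define F G where "F w = (\<chi> r c. w $ (False, r, c))" and "G w = (\<chi> r c. w $ (True, r, c))"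
    for w :: "'k^(bool \<times> 3 \<times> 3)"
  define h where "h m w = (\<chi> x. (G w ** m $ fst x - m $ fst x ** F w) $ fst (snd x) $ snd (snd x))"
    for m :: "'k^3^3^3" and w :: "'k^(bool \<times> 3 \<times> 3)"
  define L where "L m = (matrix (h m) :: 'k^(bool \<times> 3 \<times> 3)^(3 \<times> 3 \<times> 3))" for m
  let ?\<gamma> = "segment_triple u v"
  have lin: "Vector_Spaces.linear (*s) (*s) (h m :: 'k^(bool \<times> 3 \<times> 3) \<Rightarrow> 'k^(3 \<times> 3 \<times> 3))" for m
    by (intro Vector_Spaces.linear_iff[THEN iffD2])
      (simp add: vec.vector_space_axioms h_def F_def G_def vec_eq_iff matrix_matrix_mult_def
        algebra_simps sum.distrib sum_distrib_left)
  have ker: "L m *v w = 0 \<longleftrightarrow> (F w, G w) \<in> intertwiners m" for m w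
  proof -
    have "L m *v w = 0 \<longleftrightarrow> h m w = (0 :: 'k^(3 \<times> 3 \<times> 3))" by (simp add: L_def matrix_works lin)
    also have "\<dots> \<longleftrightarrow> (\<forall>a r c. (G w ** m $ a) $ r $ c = (m $ a ** F w) $ r $ c)"
      by (simp add: h_def vec_eq_iff[of _ 0])
    also have "\<dots> \<longleftrightarrow> (F w, G w) \<in> intertwiners m"
      by (simp add: intertwiners_def vec_eq_iff)
    finally show ?thesis .
  qed
  have surj: "\<exists>w. F w = A \<and> G w = B" for A B
    by (rule exI[of _ "\<chi> x. (if fst x then B else A) $ fst (snd x) $ snd (snd x)"])
      (simp add: F_def G_def)
  have incl: "intertwiners u \<subseteq> intertwiners (?\<gamma> t)" for t
  proof (rule subrelI)
    fix A B assume "(A, B) \<in> intertwiners u"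
    moreover from this have "(A, B) \<in> intertwiners v" using assms by simp
    ultimately show "(A, B) \<in> intertwiners (?\<gamma> t)"
      by (simp add: intertwiners_def segment_triple_def segment_mat_intertwines)
  qed
  have "polynomial_curve (\<lambda>t. L (?\<gamma> t) $ i $ j)" for i j
    by (auto simp: L_def matrix_def h_def matrix_matrix_mult_def segment_triple_def
        intro!: polynomial_curve_diff polynomial_curve_sum polynomial_curve_mult
          polynomial_curve_segment_mat)
  moreover have "L (?\<gamma> t) *v w = 0" if "L (?\<gamma> 0) *v w = 0" for t w
    using that incl ker by auto
  ultimately have "finite {t. \<exists>w. L (?\<gamma> t) *v w = 0 \<and> L (?\<gamma> 0) *v w \<noteq> 0}"
    by (rule kernel_generically_constant)
  moreover have "\<exists>w. L (?\<gamma> t) *v w = 0 \<and> L (?\<gamma> 0) *v w \<noteq> 0"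
    if t: "intertwiners (?\<gamma> t) \<noteq> intertwiners u" for t
  proof -
    obtain A B where AB: "(A, B) \<in> intertwiners (?\<gamma> t)" "(A, B) \<notin> intertwiners u"
      using t incl[of t] by (metis subrelI subset_antisym)
    moreover obtain w where "F w = A" "G w = B" using surj by blast
    ultimately have "L (?\<gamma> t) *v w = 0 \<and> L (?\<gamma> 0) *v w \<noteq> 0" by (simp add: ker)
    then show ?thesis ..
  qed
  then have "{t. intertwiners (?\<gamma> t) \<noteq> intertwiners u} \<subseteq>
      {t. \<exists>w. L (?\<gamma> t) *v w = 0 \<and> L (?\<gamma> 0) *v w \<noteq> 0}" by blast
  ultimately show ?thesis by (rule finite_subset[rotated])
qed

definition piece :: "(('k::field^3^3) \<times> ('k^3^3)) set \<Rightarrow> ('k^3^3^3) set" where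
  "piece E = {m. \<exists>v. equivalent_triples m v \<and> intertwiners v = E}"

text \<open>The base changes and the normalised triple are moved along segments simultaneously. The
  resulting curve can leave the piece only where a base change becomes singular or the endomorphism
  algebra grows, and each happens finitely often.\<close>

lemma vanishing_prime_piece:
  fixes E :: "(('k::alg_closed_field^3^3) \<times> ('k^3^3)) set"
  assumes "piece E \<noteq> {}"
  shows "vanishing_prime {\<lambda>m. m $ a $ r $ c | a r c. True} (piece E)"
proof (rule vanishing_prime_if_curves[OF assms])
  fix p q assume p: "p \<in> piece E" and q: "q \<in> piece E"
  obtain A0 B0 v0 where 0: "invertible A0" "invertible B0" "intertwiners v0 = E"
    "\<And>a. p $ a = A0 ** v0 $ a ** B0" using p by (auto simp: piece_def equivalent_triples_def)
  obtain A1 B1 v1 where 1: "invertible A1" "invertible B1" "intertwiners v1 = E"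
    "\<And>a. q $ a = A1 ** v1 $ a ** B1" using q by (auto simp: piece_def equivalent_triples_def)
  define A B v where "A = segment_mat A0 A1" and "B = segment_mat B0 B1"
    and "v = segment_triple v0 v1"
  define \<gamma> where "\<gamma> t = (\<chi> a. A t ** v t $ a ** B t)" for t
  have "\<gamma> 0 = p" "\<gamma> 1 = q"
    by (simp_all add: \<gamma>_def A_def B_def v_def vec_eq_iff 0 1)
  moreover have "polynomial_curve (\<lambda>t. x (\<gamma> t))" if "x \<in> {\<lambda>m. m $ a $ r $ c | a r c. True}" for x
    using that
    by (auto simp: \<gamma>_def A_def B_def v_def matrix_matrix_mult_def segment_triple_def
        intro!: polynomial_curve_sum polynomial_curve_mult polynomial_curve_segment_mat)
  moreover have "finite {t. \<gamma> t \<notin> piece E}"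
  proof -
    have "finite {t. det (A t) = 0}" "finite {t. det (B t) = 0}"
      unfolding A_def B_def using 0
      by (auto intro!: polynomial_curve_finite_zeros[where t\<^sub>0 = 0] polynomial_curve_det
          polynomial_curve_segment_mat simp: invertible_det_nz)
    moreover have "finite {t. intertwiners (v t) \<noteq> E}"
      using intertwiners_generically_constant[of v0 v1] 0 1 by (simp add: v_def)
    ultimately have "finite ({t. det (A t) = 0} \<union> {t. det (B t) = 0} \<union> {t. intertwiners (v t) \<noteq> E})"
      by simp
    moreover have "{t. \<gamma> t \<notin> piece E} \<subseteq>
        {t. det (A t) = 0} \<union> {t. det (B t) = 0} \<union> {t. intertwiners (v t) \<noteq> E}"
      by (auto simp: piece_def equivalent_triples_def \<gamma>_def invertible_det_nz)
    ultimately show ?thesis by (rule finite_subset[rotated])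
  qed
  ultimately show "\<exists>\<gamma>. \<gamma> 0 = p \<and> \<gamma> 1 = q \<and>
      (\<forall>x\<in>{\<lambda>m. m $ a $ r $ c | a r c. True}. polynomial_curve (\<lambda>t. x (\<gamma> t))) \<and>
      finite {t. \<gamma> t \<notin> piece E}" by blast
qed

lemma dim_End_equivalent:
  "equivalent_triples m v \<Longrightarrow> dim_End kronecker3 (rep m) = dim_End kronecker3 (rep v)"
  by (elim equivalent_triplesE) (rule dim_End_conj, auto)

text \<open>After a change of bases all points of the piece have the same
  \<open>intertwiners\<close>, and locality and dim End are read off from that set.\<close>

lemma piece_subset_U_kronecker:
  assumes "m \<in> piece E" "m \<in> U_kronecker i"
  shows "piece E \<subseteq> U_kronecker i"
proof
  fix m' assume "m' \<in> piece E"
  then obtain w where w: "equivalent_triples m' w" "intertwiners w = E" by (auto simp: piece_def)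
  obtain v where v: "equivalent_triples m v" "intertwiners v = E" using assms by (auto simp: piece_def)
  have "local_triple v"
    using assms(2) local_triple_equivalent[OF v(1)]
    by (simp add: U_kronecker_def indecomposable_iff_local_triple)
  then have "local_triple w" using v w by (simp add: local_triple_def)
  then have "local_triple m'" using local_triple_equivalent equivalent_triples_sym w by blast
  moreover have "dim_End kronecker3 (rep m') = dim_End kronecker3 (rep m)"
    unfolding dim_End_equivalent[OF v(1)] dim_End_equivalent[OF w(1)]
    using v w by (simp add: dim_End_def End_rep_kronecker3)
  ultimately show "m' \<in> U_kronecker i"
    using assms(2) by (simp add: U_kronecker_def indecomposable_iff_local_triple)
qed

section \<open>Classification of the endomorphism algebras\<close>

lemma basis3:
  fixes w e f :: "'k::field^3"
  assumes ind: "\<And>a b c. a *s w + b *s e + c *s f = 0 \<Longrightarrow> a = 0 \<and> b = 0 \<and> c = 0"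
  obtains P P' where "P ** P' = mat 1" "P' ** P = mat 1"
    "\<forall>x :: 'k^3. P *v x = x $ 1 *s w + x $ 2 *s e + x $ 3 *s f"
proof -
  define P :: "'k^3^3" where "P = (\<chi> r c. if c = 1 then w $ r else if c = 2 then e $ r else f $ r)"
  have P: "P *v x = x $ 1 *s w + x $ 2 *s e + x $ 3 *s f" for x
    by (simp add: P_def vec_eq_iff matrix_vector_mult_def sum_3 mult.commute)
  have "x = 0" if "P *v x = 0" for x
    using ind[of "x $ 1" "x $ 2" "x $ 3"] that by (simp add: P vec_eq_iff forall_3)
  then have "\<exists>P'. P' ** P = mat 1" unfolding matrix_left_invertible_ker by simp
  then obtain P' where "P' ** P = mat 1" ..
  moreover from this have "P ** P' = mat 1" by (simp add: matrix_left_right_inverse)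
  ultimately show thesis using that P by blast
qed

lemma low_mult_vec:
  "low s p q r *v x = vector [s * x $ 1, p * x $ 1 + s * x $ 2, q * x $ 1 + r * x $ 2 + s * x $ 3]"
  by (simp add: vec_eq_iff forall_3 matrix_vector_mult_def sum_3 vector_3)

lemma conj_eq_if_intertwines:
  fixes F L P :: "'k::field^3^3"
  assumes "P' ** P = mat 1" "\<And>x. F *v (P *v x) = P *v (L *v x)"
  shows "P' ** F ** P = L"
proof -
  have "F ** P = P ** L" using assms(2) by (simp add: matrix_eq flip: matrix_vector_mul_assoc)
  then have "P' ** F ** P = P' ** P ** L" by (simp flip: matrix_mul_assoc)
  then show ?thesis by (simp add: assms(1))
qed

text \<open>The basis is \<open>w\<close>, F w, F (F w) with the last vector nonzero; applying
  \<open>F\<close> to a linear relation isolates its coefficients one by one.\<close>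

lemma nilpotent_cyclic_form:
  fixes F :: "'k::field^3^3"
  assumes "F ** F ** F = 0" "F ** F \<noteq> 0"
  obtains P P' where "P ** P' = mat 1" "P' ** P = mat 1" "P' ** F ** P = low 0 1 0 1"
proof -
  obtain w where w: "F *v (F *v w) \<noteq> 0"
    using assms(2) by (auto simp: matrix_eq matrix_vector_mul_assoc)
  define e f where "e = F *v w" and "f = F *v e"
  have F: "F *v w = e" "F *v e = f" "F *v f = 0" and f: "f \<noteq> 0"
    using assms(1) w by (simp_all add: e_def f_def matrix_vector_mul_assoc matrix_mul_assoc)
  have lin: "F *v (a *s u + b *s v) = a *s (F *v u) + b *s (F *v v)" for a b u v
    by (simp add: matrix_vector_right_distrib vector_scalar_commute)
  have lin3: "F *v (a *s u + b *s v + c *s x) = a *s (F *v u) + b *s (F *v v) + c *s (F *v x)"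
    for a b c u v x
    by (simp add: matrix_vector_right_distrib vector_scalar_commute)
  have ind: "a = 0 \<and> b = 0 \<and> c = 0" if 0: "a *s w + b *s e + c *s f = 0" for a b c
  proof -
    have 1: "a *s e + b *s f = 0" using arg_cong[OF 0, of "(*v) F"] by (simp add: lin3 F)
    have 2: "a *s f = 0" using arg_cong[OF 1, of "(*v) F"] by (simp add: lin F)
    then have "a = 0" using f by simp
    moreover from this have "b = 0" using 1 f by simp
    ultimately show ?thesis using 0 f by simp
  qed
  obtain P P' where P: "P ** P' = mat 1" "P' ** P = mat 1"
    "\<forall>x :: 'k^3. P *v x = x $ 1 *s w + x $ 2 *s e + x $ 3 *s f"
    by (rule basis3[OF ind])
  have "P' ** F ** P = low 0 1 0 1"
    by (rule conj_eq_if_intertwines[OF P(2)]) (simp add: P(3) lin3 F low_mult_vec vector_3)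
  then show thesis using that P(1,2) by blast
qed

text \<open>The basis is \<open>w\<close>, \<open>z\<close>, \<open>e\<close> with e = F w and
  \<open>z\<close> a second kernel vector. Putting \<open>e\<close> last places the single 1 in the
  lower left corner.\<close>

lemma square_zero_form:
  fixes F :: "'k::field^3^3"
  assumes "F ** F = 0" "F \<noteq> 0"
  obtains P P' where "P ** P' = mat 1" "P' ** P = mat 1" "P' ** F ** P = low 0 0 1 0"
proof -
  obtain w where w: "F *v w \<noteq> 0" using assms(2) by (auto simp: matrix_eq)
  define e where "e = F *v w"
  have F: "F *v w = e" "F *v e = 0" and e: "e \<noteq> 0"
    using assms(1) w by (simp_all add: e_def matrix_vector_mul_assoc)
  have FF: "F *v (F *v v) = 0" for v using assms(1) by (simp add: matrix_vector_mul_assoc)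
  have lin3: "F *v (a *s u + b *s v + c *s x) = a *s (F *v u) + b *s (F *v v) + c *s (F *v x)"
    for a b c u v x
    by (simp add: matrix_vector_right_distrib vector_scalar_commute)
  have "vec.span {w, e} \<noteq> (UNIV :: ('k^3) set)"
  proof
    assume "vec.span {w, e} = (UNIV :: ('k^3) set)"
    then have "vec.dim (UNIV :: ('k^3) set) \<le> card {w, e}"
      by (intro vec.dim_le_card) auto
    then have "CARD(3) \<le> card {w, e}" unfolding vec_dim_card .
    also have "\<dots> \<le> 2" by (simp add: card_insert_if)
    finally show False by simp
  qed
  then obtain z0 where z0: "z0 \<notin> vec.span {w, e}" by blast
  have ind: "a = 0 \<and> b = 0 \<and> c = 0" if 0: "a *s w + b *s z0 + c *s e = 0" for a b c
  proof -
    have "b = 0"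
    proof (rule ccontr)
      assume b: "b \<noteq> 0"
      have "b *s z0 = - a *s w + - c *s e"
        using 0 by (simp add: vec_eq_iff forall_3) (simp add: eq_neg_iff_add_eq_0 algebra_simps)
      then have "inverse b *s (b *s z0) \<in> vec.span {w, e}"
        by (metis insertI1 insertI2 vec.span_add vec.span_base vec.span_scale)
      then show False using b z0 by simp
    qed
    moreover have "a *s (F *v w) + b *s (F *v z0) + c *s (F *v e) = F *v 0"
      unfolding 0[symmetric] lin3 ..
    ultimately have "a = 0" "b = 0" using e by (simp_all add: F)
    then show ?thesis using 0 e by simp
  qed
  obtain P P' where P: "P ** P' = mat 1" "P' ** P = mat 1"
    "\<forall>x :: 'k^3. P *v x = x $ 1 *s w + x $ 2 *s z0 + x $ 3 *s e"
    by (rule basis3[OF ind])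
  have "F *v z0 = P *v (P' *v (F *v z0))"
    by (metis P(1) matrix_vector_mul_assoc matrix_vector_mul_lid)
  then obtain a b c where abc: "F *v z0 = a *s w + b *s z0 + c *s e" using P(3) by metis
  have "F *v (a *s w + b *s z0 + c *s e) = a *s e + b *s (F *v z0)"
    unfolding lin3 F by simp
  then have "a *s e + b *s (a *s w + b *s z0 + c *s e) = 0"
    using FF[of z0, unfolded abc] by (simp add: abc)
  then have "(b * a) *s w + (b * b) *s z0 + (a + b * c) *s e = 0"
    by (simp add: vec_eq_iff algebra_simps)
  from ind[OF this] have b: "b = 0" "a = 0" by auto
  \<comment> \<open>\<open>F *v z0\<close> has turned out to be \<open>c *s e\<close>, so
    subtracting \<open>c *s w\<close> moves \<open>z0\<close> into the kernel.\<close>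
  define z where "z = z0 - c *s w"
  have Fz: "F *v z = 0"
    using abc b by (simp add: z_def matrix_vector_mult_diff_distrib vector_scalar_commute F)
  have ind': "a = 0 \<and> b = 0 \<and> d = 0" if 0: "a *s w + b *s z + d *s e = 0" for a b d
  proof -
    have "(a - b * c) *s w + b *s z0 + d *s e = 0"
      using 0 by (simp add: z_def vec_eq_iff algebra_simps)
    from ind[OF this] show ?thesis by auto
  qed
  obtain P P' where P: "P ** P' = mat 1" "P' ** P = mat 1"
    "\<forall>x :: 'k^3. P *v x = x $ 1 *s w + x $ 2 *s z + x $ 3 *s e"
    by (rule basis3[OF ind'])
  have "P' ** F ** P = low 0 0 1 0"
    by (rule conj_eq_if_intertwines[OF P(2)]) (simp add: P(3) lin3 F Fz low_mult_vec vector_3)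
  then show thesis using that P(1,2) by blast
qed

definition square_zero_triple :: "'k::field^3^3^3 \<Rightarrow> bool" where
  "square_zero_triple m \<longleftrightarrow> (\<forall>(F, G)\<in>intertwiners m.
     F ** F ** F = 0 \<longrightarrow> G ** G ** G = 0 \<longrightarrow> F ** F = 0 \<and> G ** G = 0)"

lemma square_zero_tripleD:
  assumes "square_zero_triple m" "(F, G) \<in> intertwiners m" "F ** F ** F = 0" "G ** G ** G = 0"
  shows "F ** F = 0" "G ** G = 0"
  using assms unfolding square_zero_triple_def by fast+

lemma square_zero_triple_equivalent:
  assumes "equivalent_triples m v" "square_zero_triple m"
  shows "square_zero_triple v"
  unfolding square_zero_triple_def
proof (intro ballI, clarify)
  fix F G assume FG: "(F, G) \<in> intertwiners v" "F ** F ** F = 0" "G ** G ** G = 0"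
  obtain A A' B B' where 1: "A ** A' = mat 1" "A' ** A = mat 1" "B ** B' = mat 1" "B' ** B = mat 1"
    and 2: "\<forall>a. m $ a = A ** v $ a ** B" using assms(1) by (rule equivalent_triplesE)
  have "(B' ** F ** B, A ** G ** A') \<in> intertwiners m"
    by (rule intertwiners_conj[OF 1(2,3) 2[rule_format] FG(1)])
  from square_zero_tripleD[OF assms(2) this] show "F ** F = 0 \<and> G ** G = 0"
    using FG by (simp add: conj_mult conj_eq_0_iff 1)
qed

lemma change_of_basis:
  assumes "P ** P' = mat 1" "P' ** P = mat 1" "Q ** Q' = mat 1" "Q' ** Q = mat 1"
  obtains v where "equivalent_triples m v"
    "\<forall>F G. (F, G) \<in> intertwiners m \<longrightarrow> (P' ** F ** P, Q' ** G ** Q) \<in> intertwiners v"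
proof
  let ?v = "\<chi> a. Q' ** m $ a ** P"
  show "equivalent_triples m ?v"
    by (rule equivalent_triples_sym, rule equivalent_triplesI[OF assms(4,3,1,2)]) simp
  show "\<forall>F G. (F, G) \<in> intertwiners m \<longrightarrow> (P' ** F ** P, Q' ** G ** Q) \<in> intertwiners ?v"
    using intertwiners_conj[OF assms(3,1), of ?v m] by simp
qed

lemma low_inject [simp]:
  "low s p q r = low s' p' q' r' \<longleftrightarrow> s = s' \<and> p = p' \<and> q = q' \<and> r = r'"
  by (auto simp: mat3_eq_iff)

lemma low_add: "low s p q r + low s' p' q' r' = low (s + s') (p + p') (q + q') (r + r')"
  and low_diff: "low s p q r - low s' p' q' r' = low (s - s') (p - p') (q - q') (r - r')"
  and low_scale: "mat c ** low s p q r = low (c * s) (c * p) (c * q) (c * r)"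
  and mat_low: "mat c = low c 0 0 0"
  by (simp_all add: mat3_eq_iff mult3_nth)

lemma intertwiners_scale:
  "(F, G) \<in> intertwiners m \<Longrightarrow> (mat c ** F, mat c ** G) \<in> intertwiners m"
  by (rule intertwiners_mult[OF intertwiners_mat])

lemma intertwiners_low_combination:
  assumes "(low s p q r, low s' p' q' r') \<in> intertwiners m"
    and "(low t a b c, low t' a' b' c') \<in> intertwiners m"
  shows "(low (s + x * t) (p + x * a) (q + x * b) (r + x * c),
    low (s' + x * t') (p' + x * a') (q' + x * b') (r' + x * c')) \<in> intertwiners m"
  using intertwiners_add[OF assms(1) intertwiners_scale[OF assms(2), of x]]
  by (simp add: low_scale low_add)

lemma intertwiners_low_scalar: "(low s 0 0 0, low s 0 0 0) \<in> intertwiners m"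
  using intertwiners_mat[of s] by (simp add: mat_low)

section \<open>The algebra generated by a Jordan block\<close>

text \<open>With J the Jordan block, the two matrices are u = 1 + c J^2 and J' = J + d J^2. The
  first equation says that G is F conjugated by u; then F commutes with the product of the inverse
  of u and J', which is J' again. As J' generates k[J], F lies in k[J], and so G = F.\<close>

lemma jordan_commutant:
  fixes F G :: "'k::field^3^3"
  assumes U: "G ** low 1 0 c 0 = low 1 0 c 0 ** F" and V: "G ** low 0 1 d 1 = low 0 1 d 1 ** F"
  shows "\<exists>s p q. F = low s p q p \<and> G = low s p q p"
proof -
  have F0: "F $ 1 $ 2 = 0" "F $ 1 $ 3 = 0" "F $ 2 $ 3 = 0"
    and G0: "G $ 1 $ 2 = 0" "G $ 1 $ 3 = 0" "G $ 2 $ 3 = 0"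
    using U V unfolding mat3_eq_iff mult3_nth by auto
  have "F $ 2 $ 2 = F $ 1 $ 1" "F $ 3 $ 3 = F $ 1 $ 1" "F $ 3 $ 2 = F $ 2 $ 1"
    "G $ 1 $ 1 = F $ 1 $ 1" "G $ 2 $ 2 = F $ 1 $ 1" "G $ 3 $ 3 = F $ 1 $ 1"
    "G $ 2 $ 1 = F $ 2 $ 1" "G $ 3 $ 2 = F $ 2 $ 1" "G $ 3 $ 1 = F $ 3 $ 1"
    using U V F0 G0 unfolding mat3_eq_iff mult3_nth by (auto simp: algebra_simps)
  then have "F = low (F $ 1 $ 1) (F $ 2 $ 1) (F $ 3 $ 1) (F $ 2 $ 1) \<and>
      G = low (F $ 1 $ 1) (F $ 2 $ 1) (F $ 3 $ 1) (F $ 2 $ 1)"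
    using F0 G0 by (simp add: mat3_eq_iff)
  then show ?thesis by blast
qed

text \<open>Commuting with J puts every \<open>v $ a\<close> into k[J]. If the pairs of diagonal and
  subdiagonal coefficients were all proportional, a nontrivial idempotent endomorphism would exist.
  Otherwise linear combinations of the arrows give 1 and J up to multiples of J^2.\<close>

lemma intertwiners_jordan:
  assumes loc: "local_triple v" and J: "(low 0 1 0 1, low 0 1 0 1) \<in> intertwiners v"
  shows "intertwiners v = {(low s p q p, low s p q p) | s p q. True}"
proof
  define \<alpha> \<beta> \<gamma> where "\<alpha> a = v $ a $ 1 $ 1" and "\<beta> a = v $ a $ 2 $ 1" and "\<gamma> a = v $ a $ 3 $ 1" for a
  have v: "v $ a = low (\<alpha> a) (\<beta> a) (\<gamma> a) (\<beta> a)" for a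
    using J by (simp add: intertwiners_def mat3_eq_iff mult3_nth \<alpha>_def \<beta>_def \<gamma>_def)
  show "{(low s p q p, low s p q p) | s p q. True} \<subseteq> intertwiners v"
    by (auto simp: intertwiners_def v mat3_eq_iff mult3_nth algebra_simps)
  have "\<exists>a b. \<alpha> a * \<beta> b - \<alpha> b * \<beta> a \<noteq> 0"
  proof (rule ccontr)
    assume "\<not> ?thesis"
    then have dep: "\<alpha> a * \<beta> b = \<alpha> b * \<beta> a" for a b by auto
    show False
    proof (cases "\<forall>a. \<alpha> a = 0")
      case True
      let ?X = "vector [vector [0, 0, 0], vector [0, 0, 0], vector [0, 0, 1]] :: 'a^3^3"
      have "(?X, 0) \<in> intertwiners v"
        using True by (simp add: intertwiners_def v mat3_eq_iff mult3_nth vector_3)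
      from local_triple_Source_eq_0[OF loc this] show False by (simp add: mat3_eq_iff vector_3)
    next
      case False
      then obtain a0 where a0: "\<alpha> a0 \<noteq> 0" by blast
      define l where "l = \<beta> a0 / \<alpha> a0"
      have \<beta>: "\<beta> a = l * \<alpha> a" for a using dep[of a0 a] a0 by (simp add: l_def field_simps)
      \<comment> \<open>Here each arrow is a multiple of 1 + l J plus a multiple of J^2.
        \<open>?F\<close> is E22 and \<open>?G\<close> is its conjugate by 1 + l J; moreover
        \<open>?G\<close> times J^2 and J^2 times \<open>?F\<close> are both zero.\<close>
      let ?F = "vector [vector [0, 0, 0], vector [0, 1, 0], vector [0, 0, 0]] :: 'a^3^3"
      let ?G = "vector [vector [0, 0, 0], vector [- l, 1, 0], vector [- l * l, l, 0]] :: 'a^3^3"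
      have "(?F, ?G) \<in> intertwiners v"
        by (simp add: intertwiners_def v \<beta> mat3_eq_iff mult3_nth vector_3 algebra_simps)
      moreover have "?F ** ?F = ?F" "?G ** ?G = ?G" by (simp_all add: mat3_eq_iff mult3_nth vector_3)
      ultimately have "?F = 0 \<or> ?F = mat 1" using local_tripleD[OF loc] by blast
      then show False by (simp add: mat3_eq_iff vector_3)
    qed
  qed
  then obtain a b \<delta> where \<delta>_def: "\<delta> = \<alpha> a * \<beta> b - \<alpha> b * \<beta> a" and \<delta>0: "\<delta> \<noteq> 0" by blast
  show "intertwiners v \<subseteq> {(low s p q p, low s p q p) | s p q. True}"
  proof (rule subrelI)
    fix F G assume FG: "(F, G) \<in> intertwiners v"
    have pencil:
      "G ** low (x * \<alpha> a + y * \<alpha> b) (x * \<beta> a + y * \<beta> b) (x * \<gamma> a + y * \<gamma> b) (x * \<beta> a + y * \<beta> b)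
        = low (x * \<alpha> a + y * \<alpha> b) (x * \<beta> a + y * \<beta> b) (x * \<gamma> a + y * \<gamma> b) (x * \<beta> a + y * \<beta> b) ** F"
      for x y
    proof -
      have sc: "mat c ** A = A ** mat c" for c and A :: "'a^3^3"
        by (simp add: mat3_eq_iff mult3_nth)
      have "G ** (mat x ** v $ a + mat y ** v $ b) = mat x ** (G ** v $ a) + mat y ** (G ** v $ b)"
        unfolding matrix_add_ldistrib by (metis matrix_mul_assoc sc)
      also have "\<dots> = (mat x ** v $ a + mat y ** v $ b) ** F"
        using FG by (simp add: intertwiners_def matrix_add_rdistrib matrix_mul_assoc)
      finally show ?thesis by (simp add: v low_scale low_add)
    qed
    \<comment> \<open>Cramer's rule: two combinations with coefficient pairs (1, 0) and (0, 1).
      Their corner entries remain unspecified; they are the \<open>c\<close> and \<open>d\<close> of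
      \<open>jordan_commutant\<close>.\<close>
    have 1: "\<beta> b / \<delta> * \<alpha> a + - \<beta> a / \<delta> * \<alpha> b = 1" "\<beta> b / \<delta> * \<beta> a + - \<beta> a / \<delta> * \<beta> b = 0"
      "- \<alpha> b / \<delta> * \<alpha> a + \<alpha> a / \<delta> * \<alpha> b = 0" "- \<alpha> b / \<delta> * \<beta> a + \<alpha> a / \<delta> * \<beta> b = 1"
      using \<delta>0 by (simp_all add: divide_simps) (simp_all add: \<delta>_def algebra_simps)
    have "\<exists>s p q. F = low s p q p \<and> G = low s p q p"
      using pencil[of "\<beta> b / \<delta>" "- \<beta> a / \<delta>"] pencil[of "- \<alpha> b / \<delta>" "\<alpha> a / \<delta>"] unfolding 1
      by (rule jordan_commutant)
    then show "(F, G) \<in> {(low s p q p, low s p q p) | s p q. True}" by blast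
  qed
qed

section \<open>The square-zero case\<close>

text \<open>Let N be the corner unit E31. Once \<open>s\<close> is known to vanish, the two
  equations give F N + N F = 0, which clears the entries above the diagonal; then
  \<open>F ** F = 0\<close> clears the diagonal and leaves \<open>p * r = 0\<close>.\<close>

lemma square_zero_shift:
  fixes F :: "'k::field^3^3"
  assumes F: "F ** F = 0"
    and S: "(F + low 0 0 1 0 - mat s) ** (F + low 0 0 1 0 - mat s) = 0"
  shows "\<exists>p q r. F = low 0 p q r \<and> p * r = 0"
proof -
  define a b c d e f g h i where "a = F $ 1 $ 1" and "b = F $ 1 $ 2" and "c = F $ 1 $ 3"
    and "d = F $ 2 $ 1" and "e = F $ 2 $ 2" and "f = F $ 2 $ 3"
    and "g = F $ 3 $ 1" and "h = F $ 3 $ 2" and "i = F $ 3 $ 3"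
  note defs = a_def b_def c_def d_def e_def f_def g_def h_def i_def
  have F1: "a * a + b * d + c * g = 0" "d * b + e * e + f * h = 0" "g * c + h * f + i * i = 0"
    "a * b + b * e + c * h = 0" "a * c + b * f + c * i = 0" "d * a + e * d + f * g = 0"
    "d * c + e * f + f * i = 0" "g * a + h * d + i * g = 0" "g * b + h * e + i * h = 0"
    using F by (simp_all add: mat3_eq_iff mult3_nth flip: defs)
  have S1: "(a - s) * (a - s) + b * d + c * (g + 1) = 0"
    "d * b + (e - s) * (e - s) + f * h = 0"
    "(a - s) * b + b * (e - s) + c * h = 0"
    "(a - s) * c + b * f + c * (i - s) = 0"
    "d * c + (e - s) * f + f * (i - s) = 0"
    "(g + 1) * (a - s) + h * d + (i - s) * (g + 1) = 0"
    "d * (a - s) + (e - s) * d + f * (g + 1) = 0"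
    "(g + 1) * b + h * (e - s) + (i - s) * h = 0"
    using S by (simp_all add: mat3_eq_iff mult3_nth flip: defs)
  \<comment> \<open>Traces would give only 3 s = 0, which says nothing in characteristic three. The
    (2, 2) entries give 2 e = s instead, so 2 is invertible as soon as s is nonzero.\<close>
  have "s = 0"
  proof (rule ccontr)
    assume s: "s \<noteq> 0"
    have "s * (s - 2 * e) = 0" using F1(2) S1(2) by algebra
    then have e: "2 * e = s" using s by simp
    then have two: "(2::'k) \<noteq> 0" using s by auto
    have "2 * s * b = 0" using F1(4) S1(3) by algebra
    then have b: "b = 0" using s two by simp
    have "2 * s * c = 0" using F1(5) S1(4) by algebra
    then have c: "c = 0" using s two by simp
    have "a = 0" using F1(1) b c by simp
    moreover have "(a - s) * (a - s) = 0" using S1(1) b c by simp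
    ultimately show False using s by simp
  qed
  moreover from this have "c = 0" using F1(1) S1(1) by algebra
  moreover from calculation have "f = 0" using F1(6) S1(7) by algebra
  moreover from calculation have "b = 0" using F1(9) S1(8) by algebra
  moreover from calculation have "a = 0" "e = 0" "i = 0" using F1(1-3) by simp_all
  moreover from calculation have "d * h = 0" using F1(8) by auto
  ultimately have "F = low 0 d g h" "d * h = 0" by (simp_all add: mat3_eq_iff flip: defs)
  then show ?thesis by blast
qed

locale square_zero_normalized =
  fixes v :: "'k::alg_closed_field^3^3^3"
  assumes loc: "local_triple v" and sq: "square_zero_triple v"
    and N: "(low 0 0 1 0, low 0 0 1 0) \<in> intertwiners v"
begin

text \<open>Locality is applied twice: to the endomorphism, giving a nilpotent part
  \<open>H\<close>, and to \<open>H\<close> plus the corner unit. Both nilpotent parts have square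
  zero, which is the input of \<open>square_zero_shift\<close> at each vertex.\<close>

lemma general_form:
  assumes "(F, G) \<in> intertwiners v"
  obtains s p q r p' q' r' where "F = low s p q r" "G = low s p' q' r'" "p * r = 0" "p' * r' = 0"
proof -
  obtain s where s: "(F - mat s) ** (F - mat s) ** (F - mat s) = 0"
    "(G - mat s) ** (G - mat s) ** (G - mat s) = 0"
    using local_triple_nilpotent[OF loc assms] by blast
  define H K where "H = F - mat s" and "K = G - mat s"
  have HK: "(H, K) \<in> intertwiners v"
    unfolding H_def K_def using assms intertwiners_mat by (rule intertwiners_diff)
  have HN: "(H + low 0 0 1 0, K + low 0 0 1 0) \<in> intertwiners v" by (rule intertwiners_add[OF HK N])
  obtain t where t:
    "(H + low 0 0 1 0 - mat t) ** (H + low 0 0 1 0 - mat t) ** (H + low 0 0 1 0 - mat t) = 0"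
    "(K + low 0 0 1 0 - mat t) ** (K + low 0 0 1 0 - mat t) ** (K + low 0 0 1 0 - mat t) = 0"
    using local_triple_nilpotent[OF loc HN] by blast
  have HNt: "(H + low 0 0 1 0 - mat t, K + low 0 0 1 0 - mat t) \<in> intertwiners v"
    using HN intertwiners_mat by (rule intertwiners_diff)
  have "H ** H = 0" "K ** K = 0"
    using square_zero_tripleD[OF sq HK] s by (simp_all add: H_def K_def)
  then obtain p q r p' q' r' where "H = low 0 p q r" "K = low 0 p' q' r'" "p * r = 0" "p' * r' = 0"
    using square_zero_shift square_zero_tripleD[OF sq HNt t] by metis
  moreover from this have "F = low s p q r" "G = low s p' q' r'"
    by (simp_all add: H_def K_def mat_low diff_eq_eq low_add)
  ultimately show thesis using that by blast
qed

lemma strict_products: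
  assumes "(low s p q r, low s' p' q' r') \<in> intertwiners v"
  shows "p * r = 0" "p' * r' = 0"
  using general_form[OF assms] by auto

lemma corner_combination:
  assumes "(low 0 x 0 y, low 0 x' 0 y') \<in> intertwiners v"
  shows "(low s (p * x) q (p * y), low s (p * x') q (p * y')) \<in> intertwiners v"
  using intertwiners_low_combination[OF intertwiners_low_combination[OF
    intertwiners_low_scalar[of s] N, of q] assms, of p] by simp

text \<open>\<open>x\<close>, \<open>y\<close> and \<open>x'\<close>, \<open>y'\<close> record
  whether the extra generator sits at (2, 1) or at (3, 2) at each vertex. Adding it to any
  endomorphism must keep the product of these two entries zero, so the other position is empty at
  the source; the target matrix is then determined by the source matrix.\<close>

lemma intertwiners_with_corner:
  assumes X: "(low 0 x 0 y, low 0 x' 0 y') \<in> intertwiners v"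
    and xy: "x = 1 \<and> y = 0 \<or> x = 0 \<and> y = 1" and xy': "x' = 1 \<and> y' = 0 \<or> x' = 0 \<and> y' = 1"
  shows "intertwiners v =
    {(low s (p * x) q (p * y), low s (p * x') q (p * y')) | s p q. True}" (is "_ = ?E")
proof
  show "?E \<subseteq> intertwiners v" using corner_combination[OF X] by auto
  show "intertwiners v \<subseteq> ?E"
  proof (rule subrelI)
    fix F G assume FG: "(F, G) \<in> intertwiners v"
    obtain s p q r p' q' r' where form: "F = low s p q r" "G = low s p' q' r'"
      and pr: "p * r = 0" "p' * r' = 0"
      using general_form[OF FG] by blast
    have "(low s (p + 1 * x) q (r + 1 * y), low s (p' + 1 * x') q' (r' + 1 * y')) \<in> intertwiners v"
      using intertwiners_low_combination[OF FG[unfolded form] X, of 1] by simp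
    then have "(p + x) * (r + y) = 0" "(p' + x') * (r' + y') = 0"
      using strict_products by force+
    then have "p * y + x * r = 0" using pr xy by (auto simp: algebra_simps)
    then obtain c where c: "p = c * x" "r = c * y" using xy by force
    have "(F, low s (c * x') q (c * y')) \<in> intertwiners v"
      using corner_combination[OF X, of s c q] by (simp add: form c)
    then have "G = low s (c * x') q (c * y')"
      using local_triple_Target_unique[OF loc FG] by blast
    then show "(F, G) \<in> ?E" using form c by blast
  qed
qed

lemma intertwiners_without_corner:
  assumes "\<And>s p q r G. (low s p q r, G) \<in> intertwiners v \<Longrightarrow> p = 0 \<and> r = 0"
  shows "intertwiners v = {(low s 0 q 0, low s 0 q 0) | s q. True}" (is "_ = ?E")
proof
  have E: "(low s 0 q 0, low s 0 q 0) \<in> intertwiners v" for s q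
    using intertwiners_low_combination[OF intertwiners_low_scalar[of s] N, of q] by simp
  then show "?E \<subseteq> intertwiners v" by auto
  show "intertwiners v \<subseteq> ?E"
  proof (rule subrelI)
    fix F G assume FG: "(F, G) \<in> intertwiners v"
    obtain s p q r where F: "F = low s p q r" by (rule general_form[OF FG]) (rule that)
    then have "p = 0 \<and> r = 0" using assms[of s p q r G] FG by simp
    then have "F = low s 0 q 0" using F by simp
    moreover from this have "G = low s 0 q 0"
      using local_triple_Target_unique[OF loc FG, of "low s 0 q 0"] E[of s q] by simp
    ultimately show "(F, G) \<in> ?E" by blast
  qed
qed

text \<open>Together with the corner unit, such an endomorphism makes the third column of every
  arrow zero, so \<open>(E33, 0)\<close> would be an endomorphism.\<close>

lemma no_mixed_corner:
  assumes "(low 0 0 0 1, low 0 p q 0) \<in> intertwiners v"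
  shows False
proof -
  have "v $ a $ 1 $ 3 = 0 \<and> v $ a $ 2 $ 3 = 0 \<and> v $ a $ 3 $ 3 = 0" for a
    using N assms by (simp add: intertwiners_def mat3_eq_iff mult3_nth)
  then have "(vector [vector [0, 0, 0], vector [0, 0, 0], vector [0, 0, 1]], 0) \<in> intertwiners v"
    by (simp add: intertwiners_def mat3_eq_iff mult3_nth vector_3)
  from local_triple_Source_eq_0[OF loc this] show False by (simp add: mat3_eq_iff vector_3)
qed

end

text \<open>\<open>Q\<close> commutes with the corner unit, so the first generator stays normalised
  while the second one is scaled and loses its corner entry.\<close>

lemma target_change_col:
  fixes p q :: "'k::field"
  assumes "p \<noteq> 0"
  obtains Q Q' where "Q ** Q' = mat 1" "Q' ** Q = mat 1"
    "Q' ** low 0 0 1 0 ** Q = low 0 0 1 0" "Q' ** low 0 p q 0 ** Q = low 0 1 0 0"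
proof
  let ?Q = "vector [vector [1, 0, 0], vector [0, p, 0], vector [0, q, 1]] :: 'k^3^3"
  let ?Q' = "vector [vector [1, 0, 0], vector [0, 1 / p, 0], vector [0, - q / p, 1]] :: 'k^3^3"
  show "?Q ** ?Q' = mat 1" "?Q' ** ?Q = mat 1"
    "?Q' ** low 0 0 1 0 ** ?Q = low 0 0 1 0" "?Q' ** low 0 p q 0 ** ?Q = low 0 1 0 0"
    using assms by (simp_all add: mat3_eq_iff mult3_nth vector_3 field_simps)
qed

lemma target_change_row:
  fixes r q :: "'k::field"
  assumes "r \<noteq> 0"
  obtains Q Q' where "Q ** Q' = mat 1" "Q' ** Q = mat 1"
    "Q' ** low 0 0 1 0 ** Q = low 0 0 1 0" "Q' ** low 0 0 q r ** Q = low 0 0 0 1"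
proof
  let ?Q = "vector [vector [1, 0, 0], vector [- q / r, 1 / r, 0], vector [0, 0, 1]] :: 'k^3^3"
  let ?Q' = "vector [vector [1, 0, 0], vector [q, r, 0], vector [0, 0, 1]] :: 'k^3^3"
  show "?Q ** ?Q' = mat 1" "?Q' ** ?Q = mat 1"
    "?Q' ** low 0 0 1 0 ** ?Q = low 0 0 1 0" "?Q' ** low 0 0 q r ** ?Q = low 0 0 0 1"
    using assms by (simp_all add: mat3_eq_iff mult3_nth vector_3 field_simps)
qed

text \<open>In order: scalars; the corner unit E31; the Jordan block; then E31 with E21 at both
  vertices, with E32 at both, and with E21 at the source and E32 at the target. The dimensions are
  1, 2, 3, 3, 3, 3.\<close>

definition normal_algebras :: "(('k::field^3^3) \<times> ('k^3^3)) set set" where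
  "normal_algebras = {
     {(low s 0 0 0, low s 0 0 0) | s. True},
     {(low s 0 q 0, low s 0 q 0) | s q. True},
     {(low s p q p, low s p q p) | s p q. True},
     {(low s p q 0, low s p q 0) | s p q. True},
     {(low s 0 q p, low s 0 q p) | s p q. True},
     {(low s p q 0, low s 0 q p) | s p q. True}}"

lemma (in square_zero_normalized) normal_form:
  "\<exists>v'. equivalent_triples v v' \<and> intertwiners v' \<in> normal_algebras"
proof (cases "\<forall>s p q r G. (low s p q r, G) \<in> intertwiners v \<longrightarrow> p = 0 \<and> r = 0")
  case True
  then have "intertwiners v = {(low s 0 q 0, low s 0 q 0) | s q. True}"
    by (intro intertwiners_without_corner) blast
  then show ?thesis
    using equivalent_triples_refl unfolding normal_algebras_def by blast
next
  case False
  then obtain s p q r G where FG: "(low s p q r, G) \<in> intertwiners v" and pr: "p \<noteq> 0 \<or> r \<noteq> 0"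
    by blast
  obtain p1 q1 r1 where G: "G = low s p1 q1 r1" by (rule general_form[OF FG]) (auto intro: that)
  \<comment> \<open>Exactly one of \<open>p\<close> and \<open>r\<close> is nonzero;
    \<open>k\<close> is its value, and \<open>x\<close>, \<open>y\<close> mark its position.\<close>
  define k where "k = (if p = 0 then r else p)"
  define x y where "x = (if p = 0 then 0 else 1 :: 'k)" and "y = (if p = 0 then 1 else 0 :: 'k)"
  have k: "k \<noteq> 0" "p = k * x" "r = k * y"
    using pr strict_products(1)[OF FG[unfolded G]] by (auto simp: k_def x_def y_def)
  have xy: "x = 1 \<and> y = 0 \<or> x = 0 \<and> y = 1" by (simp add: x_def y_def)
  \<comment> \<open>Subtracting a scalar and a multiple of the corner unit clears the corner at the
    source only; what remains of it at the target is absorbed by the base change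
    \<open>Q\<close>.\<close>
  have "(low 0 p 0 r, low 0 p1 (q1 - q) r1) \<in> intertwiners v"
    using intertwiners_low_combination[OF intertwiners_low_combination[OF FG[unfolded G]
        intertwiners_low_scalar[of s], of "-1"] N, of "- q"] by simp
  from intertwiners_scale[OF this, of "1 / k"]
  obtain p' q' r' where FG': "(low 0 x 0 y, low 0 p' q' r') \<in> intertwiners v"
    using k by (simp add: low_scale)
  have pr': "p' * r' = 0" using strict_products[OF FG'] by blast
  have ne: "p' \<noteq> 0 \<or> r' \<noteq> 0"
  proof (rule ccontr)
    assume "\<not> ?thesis"
    then have "(low 0 x 0 y, low 0 0 q' 0) \<in> intertwiners v" using FG' by simp
    moreover have "(low 0 0 q' 0, low 0 0 q' 0) \<in> intertwiners v"
      using intertwiners_scale[OF N, of q'] by (simp add: low_scale)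
    ultimately have "low 0 x 0 y = low 0 0 q' 0" using local_triple_Source_unique[OF loc] by blast
    then show False using xy by auto
  qed
  \<comment> \<open>Only the target basis changes, the source matrix being normalised already. The
    clause on \<open>x' = 1\<close> keeps the shape of the old target matrix for
    \<open>no_mixed_corner\<close>.\<close>
  obtain x' y' Q Q' where Q: "Q ** Q' = mat 1" "Q' ** Q = mat 1"
    "Q' ** low 0 0 1 0 ** Q = low 0 0 1 0" "Q' ** low 0 p' q' r' ** Q = low 0 x' 0 y'"
    and xy': "x' = 1 \<and> y' = 0 \<or> x' = 0 \<and> y' = 1" and x': "x' = 1 \<longrightarrow> r' = 0"
  proof (cases "p' = 0")
    case True
    then show thesis using target_change_row[of r' q'] ne that[of _ _ 0 1] by auto
  next
    case False
    then show thesis using target_change_col[of p' q'] pr' that[of _ _ 1 0] by auto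
  qed
  obtain v' where v': "equivalent_triples v v'"
    "\<forall>F G. (F, G) \<in> intertwiners v \<longrightarrow> (mat 1 ** F ** mat 1, Q' ** G ** Q) \<in> intertwiners v'"
    using change_of_basis[of "mat 1" "mat 1" Q Q' v] Q by auto
  interpret v': square_zero_normalized v'
  proof
    show "local_triple v'" using local_triple_equivalent[OF v'(1) loc] .
    show "square_zero_triple v'" using square_zero_triple_equivalent[OF v'(1) sq] .
    show "(low 0 0 1 0, low 0 0 1 0) \<in> intertwiners v'" using v'(2) N Q(3) by fastforce
  qed
  have X: "(low 0 x 0 y, low 0 x' 0 y') \<in> intertwiners v'" using v'(2) FG' Q(4) by fastforce
  have I: "intertwiners v' = {(low s (p * x) q (p * y), low s (p * x') q (p * y')) | s p q. True}"
    by (rule v'.intertwiners_with_corner[OF X xy xy'])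
  have "\<not> (y = 1 \<and> x' = 1)"
  proof
    assume "y = 1 \<and> x' = 1"
    then have "(low 0 0 0 1, low 0 p' q' 0) \<in> intertwiners v" using FG' x' xy by auto
    then show False by (rule no_mixed_corner)
  qed
  then have "intertwiners v' \<in> normal_algebras"
    using xy xy' unfolding I normal_algebras_def by auto
  then show ?thesis using v'(1) by blast
qed

lemma local_triple_normal_form:
  fixes m :: "'k::alg_closed_field^3^3^3"
  assumes loc: "local_triple m"
  shows "\<exists>v. equivalent_triples m v \<and> intertwiners v \<in> normal_algebras"
proof (cases "square_zero_triple m")
  case False
  then obtain F G where FG: "(F, G) \<in> intertwiners m" "F ** F ** F = 0" "G ** G ** G = 0"
    and ne: "F ** F \<noteq> 0 \<or> G ** G \<noteq> 0"
    by (auto simp: square_zero_triple_def)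
  have 2: "(F ** F, G ** G) \<in> intertwiners m" by (rule intertwiners_mult[OF FG(1) FG(1)])
  \<comment> \<open>By faithfulness the square vanishes at one vertex only if it vanishes at both,
    so the same Jordan type occurs at both.\<close>
  have "F ** F \<noteq> 0" "G ** G \<noteq> 0"
    using ne 2 local_triple_Source_eq_0[OF loc] local_triple_Target_eq_0[OF loc] by metis+
  obtain P P' where P: "P ** P' = mat 1" "P' ** P = mat 1" "P' ** F ** P = low 0 1 0 1"
    using nilpotent_cyclic_form[OF FG(2) \<open>F ** F \<noteq> 0\<close>] .
  obtain Q Q' where Q: "Q ** Q' = mat 1" "Q' ** Q = mat 1" "Q' ** G ** Q = low 0 1 0 1"
    using nilpotent_cyclic_form[OF FG(3) \<open>G ** G \<noteq> 0\<close>] .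
  obtain v where v: "equivalent_triples m v"
    "\<forall>F G. (F, G) \<in> intertwiners m \<longrightarrow> (P' ** F ** P, Q' ** G ** Q) \<in> intertwiners v"
    using change_of_basis[OF P(1,2) Q(1,2)] .
  have "(low 0 1 0 1, low 0 1 0 1) \<in> intertwiners v" using v(2) FG(1) P(3) Q(3) by metis
  then have "intertwiners v = {(low s p q p, low s p q p) | s p q. True}"
    using intertwiners_jordan local_triple_equivalent[OF v(1) loc] by blast
  then show ?thesis using v(1) unfolding normal_algebras_def by blast
next
  case sq: True
  show ?thesis
  proof (cases "\<forall>F G. (F, G) \<in> intertwiners m \<longrightarrow> F ** F ** F = 0 \<longrightarrow> G ** G ** G = 0 \<longrightarrow> F = 0 \<and> G = 0")
    case True
    have "intertwiners m = {(low s 0 0 0, low s 0 0 0) | s. True}"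
    proof
      show "{(low s 0 0 0, low s 0 0 0) | s. True} \<subseteq> intertwiners m"
        using intertwiners_low_scalar by auto
      show "intertwiners m \<subseteq> {(low s 0 0 0, low s 0 0 0) | s. True}"
      proof (rule subrelI)
        fix F G assume FG: "(F, G) \<in> intertwiners m"
        obtain s where "(F - mat s) ** (F - mat s) ** (F - mat s) = 0"
          "(G - mat s) ** (G - mat s) ** (G - mat s) = 0"
          using local_triple_nilpotent[OF loc FG] by blast
        then have "F - mat s = 0 \<and> G - mat s = 0"
          using True intertwiners_diff[OF FG intertwiners_mat] by blast
        then show "(F, G) \<in> {(low s 0 0 0, low s 0 0 0) | s. True}" by (auto simp: mat_low)
      qed
    qed
    then show ?thesis using equivalent_triples_refl unfolding normal_algebras_def by blast
  next
    case False
    then obtain F G where FG: "(F, G) \<in> intertwiners m" "F ** F ** F = 0" "G ** G ** G = 0"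
      and ne: "F \<noteq> 0 \<or> G \<noteq> 0" by blast
    have "F \<noteq> 0" "G \<noteq> 0"
      using ne FG(1) local_triple_Source_eq_0[OF loc] local_triple_Target_eq_0[OF loc] by metis+
    note FG2 = square_zero_tripleD[OF sq FG]
    obtain P P' where P: "P ** P' = mat 1" "P' ** P = mat 1" "P' ** F ** P = low 0 0 1 0"
      using square_zero_form[OF FG2(1) \<open>F \<noteq> 0\<close>] .
    obtain Q Q' where Q: "Q ** Q' = mat 1" "Q' ** Q = mat 1" "Q' ** G ** Q = low 0 0 1 0"
      using square_zero_form[OF FG2(2) \<open>G \<noteq> 0\<close>] .
    obtain v where v: "equivalent_triples m v"
      "\<forall>F G. (F, G) \<in> intertwiners m \<longrightarrow> (P' ** F ** P, Q' ** G ** Q) \<in> intertwiners v"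
      using change_of_basis[OF P(1,2) Q(1,2)] .
    interpret square_zero_normalized v
    proof
      show "local_triple v" using local_triple_equivalent[OF v(1) loc] .
      show "square_zero_triple v" using square_zero_triple_equivalent[OF v(1) sq] .
      show "(low 0 0 1 0, low 0 0 1 0) \<in> intertwiners v" using v(2) FG(1) P(3) Q(3) by metis
    qed
    show ?thesis using normal_form equivalent_triples_trans[OF v(1)] by blast
  qed
qed

section \<open>Trees with prescribed endomorphism algebra\<close>

definition triple :: "'k::field^3^3 \<Rightarrow> 'k^3^3 \<Rightarrow> 'k^3^3 \<Rightarrow> 'k^3^3^3" where
  "triple X Y Z = vector [X, Y, Z]"

lemma triple_nth [simp]: "triple X Y Z $ 1 = X" "triple X Y Z $ 2 = Y" "triple X Y Z $ 3 = Z"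
  by (simp_all add: triple_def vector_3)

lemma intertwiners_triple:
  "intertwiners (triple X Y Z) = {(F, G). G ** X = X ** F \<and> G ** Y = Y ** F \<and> G ** Z = Z ** F}"
  by (auto simp: intertwiners_def forall_3)

definition entries :: "'k::field \<Rightarrow> 'k \<Rightarrow> 'k \<Rightarrow> 'k \<Rightarrow> 'k \<Rightarrow> 'k \<Rightarrow> 'k \<Rightarrow> 'k \<Rightarrow> 'k \<Rightarrow> 'k^3^3" where
  "entries a b c d e f g h i = vector [vector [a, b, c], vector [d, e, f], vector [g, h, i]]"

lemma entries_nth [simp]:
  "entries a b c d e f g h i $ 1 $ 1 = a" "entries a b c d e f g h i $ 1 $ 2 = b"
  "entries a b c d e f g h i $ 1 $ 3 = c" "entries a b c d e f g h i $ 2 $ 1 = d"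
  "entries a b c d e f g h i $ 2 $ 2 = e" "entries a b c d e f g h i $ 2 $ 3 = f"
  "entries a b c d e f g h i $ 3 $ 1 = g" "entries a b c d e f g h i $ 3 $ 2 = h"
  "entries a b c d e f g h i $ 3 $ 3 = i"
  by (simp_all add: entries_def vector_3)

lemma intertwiners_eqI:
  assumes "\<And>p. p \<in> E \<Longrightarrow> p \<in> intertwiners m"
    and "\<And>F G. (F, G) \<in> intertwiners m \<Longrightarrow> (F, G) \<in> E"
  shows "intertwiners m = E"
  using assms by auto

text \<open>This is the triple (1, J, 0) of the Jordan case with the (3, 3) entry of the identity
  moved to the third arrow, which leaves only scalars.\<close>

lemma intertwiners_tree_scalar:
  "intertwiners (triple (entries 1 0 0 0 1 0 0 0 0) (entries 0 0 0 1 0 0 0 1 0)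
      (entries 0 0 0 0 0 0 0 0 1))
    = {(low s 0 0 0, low s 0 0 0) | s :: 'k::field. True}"
proof (rule intertwiners_eqI)
  fix F G :: "'k^3^3"
  assume "(F, G) \<in> intertwiners (triple (entries 1 0 0 0 1 0 0 0 0) (entries 0 0 0 1 0 0 0 1 0)
      (entries 0 0 0 0 0 0 0 0 1))"
  then have "F = low (F $ 1 $ 1) 0 0 0" "G = low (F $ 1 $ 1) 0 0 0"
    by (auto simp: intertwiners_triple mat3_eq_iff mult3_nth)
  then show "(F, G) \<in> {(low s 0 0 0, low s 0 0 0) | s. True}" by blast
qed (auto simp: intertwiners_triple mat3_eq_iff mult3_nth)

text \<open>The triple (1, J, 0) with the (3, 2) entry of J moved to the third arrow: now
  \<open>F = G\<close> has to commute with E21 and E32 separately.\<close>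

lemma intertwiners_tree_corner:
  "intertwiners (triple (mat 1) (low 0 1 0 0) (low 0 0 0 1))
    = {(low s 0 q 0, low s 0 q 0) | s q :: 'k::field. True}"
proof (rule intertwiners_eqI)
  fix F G :: "'k^3^3"
  assume "(F, G) \<in> intertwiners (triple (mat 1) (low 0 1 0 0) (low 0 0 0 1))"
  then have "F = low (F $ 1 $ 1) 0 (F $ 3 $ 1) 0" "G = low (F $ 1 $ 1) 0 (F $ 3 $ 1) 0"
    by (auto simp: intertwiners_triple mat3_eq_iff mult3_nth)
  then show "(F, G) \<in> {(low s 0 q 0, low s 0 q 0) | s q. True}" by blast
qed (auto simp: intertwiners_triple mat3_eq_iff mult3_nth)

text \<open>1 and J already cut out k[J]. The third arrow is zero because the entry of J^2 would
  close a cycle in the coefficient quiver.\<close>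

lemma intertwiners_tree_jordan:
  "intertwiners (triple (mat 1) (low 0 1 0 1) 0)
    = {(low s p q p, low s p q p) | s p q :: 'k::field. True}"
proof (rule intertwiners_eqI)
  fix F G :: "'k^3^3"
  assume "(F, G) \<in> intertwiners (triple (mat 1) (low 0 1 0 1) 0)"
  then have "F = low (F $ 1 $ 1) (F $ 2 $ 1) (F $ 3 $ 1) (F $ 2 $ 1)"
    "G = low (F $ 1 $ 1) (F $ 2 $ 1) (F $ 3 $ 1) (F $ 2 $ 1)"
    by (auto simp: intertwiners_triple mat3_eq_iff mult3_nth)
  then show "(F, G) \<in> {(low s p q p, low s p q p) | s p q. True}" by blast
qed (auto simp: intertwiners_triple mat3_eq_iff mult3_nth)

text \<open>For this algebra and the next two, the matrices intertwined by all its pairs form a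
  three-dimensional space, and the arrows are a basis of it; here 1, E21, E31.\<close>

lemma intertwiners_tree_col:
  "intertwiners (triple (mat 1) (low 0 1 0 0) (low 0 0 1 0))
    = {(low s p q 0, low s p q 0) | s p q :: 'k::field. True}"
proof (rule intertwiners_eqI)
  fix F G :: "'k^3^3"
  assume "(F, G) \<in> intertwiners (triple (mat 1) (low 0 1 0 0) (low 0 0 1 0))"
  then have "F = low (F $ 1 $ 1) (F $ 2 $ 1) (F $ 3 $ 1) 0"
    "G = low (F $ 1 $ 1) (F $ 2 $ 1) (F $ 3 $ 1) 0"
    by (auto simp: intertwiners_triple mat3_eq_iff mult3_nth)
  then show "(F, G) \<in> {(low s p q 0, low s p q 0) | s p q. True}" by blast
qed (auto simp: intertwiners_triple mat3_eq_iff mult3_nth)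

lemma intertwiners_tree_row:
  "intertwiners (triple (mat 1) (low 0 0 0 1) (low 0 0 1 0))
    = {(low s 0 q p, low s 0 q p) | s p q :: 'k::field. True}"
proof (rule intertwiners_eqI)
  fix F G :: "'k^3^3"
  assume "(F, G) \<in> intertwiners (triple (mat 1) (low 0 0 0 1) (low 0 0 1 0))"
  then have "F = low (F $ 1 $ 1) 0 (F $ 3 $ 1) (F $ 3 $ 2)"
    "G = low (F $ 1 $ 1) 0 (F $ 3 $ 1) (F $ 3 $ 2)"
    by (auto simp: intertwiners_triple mat3_eq_iff mult3_nth)
  then show "(F, G) \<in> {(low s 0 q p, low s 0 q p) | s p q. True}" by blast
qed (auto simp: intertwiners_triple mat3_eq_iff mult3_nth)

lemma intertwiners_tree_mixed:
  "intertwiners (triple (entries 1 0 0 0 0 0 0 0 1) (low 0 1 0 1) (low 0 0 1 0))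
    = {(low s p q 0, low s 0 q p) | s p q :: 'k::field. True}"
proof (rule intertwiners_eqI)
  fix F G :: "'k^3^3"
  assume "(F, G) \<in> intertwiners (triple (entries 1 0 0 0 0 0 0 0 1) (low 0 1 0 1) (low 0 0 1 0))"
  then have "F = low (F $ 1 $ 1) (F $ 2 $ 1) (F $ 3 $ 1) 0"
    "G = low (F $ 1 $ 1) 0 (F $ 3 $ 1) (F $ 2 $ 1)"
    by (auto simp: intertwiners_triple mat3_eq_iff mult3_nth)
  then show "(F, G) \<in> {(low s p q 0, low s 0 q p) | s p q. True}" by blast
qed (auto simp: intertwiners_triple mat3_eq_iff mult3_nth)

lemma ex_3: "(\<exists>x :: 3. P x) \<longleftrightarrow> P 1 \<or> P 2 \<or> P 3"
  by (metis exhaust_3)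

definition depth :: "nat^3 \<Rightarrow> nat^3 \<Rightarrow> kronecker_vertex \<Rightarrow> 3 \<Rightarrow> nat" where
  "depth s t = (\<lambda>x i. (case x of Source \<Rightarrow> s | Target \<Rightarrow> t) $ i)"

text \<open>The depths are distances from the first source vertex s1. The first three coefficient
  quivers are the path t1 - s1 - t2 - s2 - t3 - s3, with different labels. In the fourth, s1 is
  joined to t1, t2, t3, with s2 at t2 and s3 at t3; in the fifth, s1 is joined to t1 and t3, t3 to
  s2 and s3, and s2 to t2; in the sixth, s1 is joined to t1, t2, t3, and t3 to s2 and s3.\<close>

lemma tree_rep_triples:
  "tree_rep kronecker3 (rep (triple (entries 1 0 0 0 1 0 0 0 0) (entries 0 0 0 1 0 0 0 1 0)
    (entries 0 0 0 0 0 0 0 0 (1::'k::field))))"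
  "tree_rep kronecker3 (rep (triple (mat 1) (low 0 1 0 0) (low 0 0 0 (1::'k))))"
  "tree_rep kronecker3 (rep (triple (mat 1) (low 0 1 0 (1::'k)) 0))"
  "tree_rep kronecker3 (rep (triple (mat 1) (low 0 1 0 0) (low 0 0 (1::'k) 0)))"
  "tree_rep kronecker3 (rep (triple (mat 1) (low 0 0 0 1) (low 0 0 (1::'k) 0)))"
  "tree_rep kronecker3 (rep (triple (entries 1 0 0 0 0 0 0 0 1) (low 0 1 0 1) (low 0 0 (1::'k) 0)))"
  subgoal
    by (rule tree_rep_if_depth[of _ "depth (vector [0, 2, 4]) (vector [1, 1, 3])"])
      (simp_all add: forall_3 ex_3 depth_def vector_3)
  subgoal
    by (rule tree_rep_if_depth[of _ "depth (vector [0, 2, 4]) (vector [1, 1, 3])"])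
      (simp_all add: forall_3 ex_3 depth_def vector_3)
  subgoal
    by (rule tree_rep_if_depth[of _ "depth (vector [0, 2, 4]) (vector [1, 1, 3])"])
      (simp_all add: forall_3 ex_3 depth_def vector_3)
  subgoal
    by (rule tree_rep_if_depth[of _ "depth (vector [0, 2, 2]) (vector [1, 1, 1])"])
      (simp_all add: forall_3 ex_3 depth_def vector_3)
  subgoal
    by (rule tree_rep_if_depth[of _ "depth (vector [0, 2, 2]) (vector [1, 3, 1])"])
      (simp_all add: forall_3 ex_3 depth_def vector_3)
  subgoal
    by (rule tree_rep_if_depth[of _ "depth (vector [0, 2, 2]) (vector [1, 1, 1])"])
      (simp_all add: forall_3 ex_3 depth_def vector_3)
  done

lemma normal_algebra_has_tree:
  assumes "E \<in> (normal_algebras :: (('k::field^3^3) \<times> ('k^3^3)) set set)"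
  shows "\<exists>w. intertwiners w = E \<and> tree_rep kronecker3 (rep w)"
  using assms intertwiners_tree_scalar intertwiners_tree_corner intertwiners_tree_jordan
    intertwiners_tree_col intertwiners_tree_row intertwiners_tree_mixed tree_rep_triples[where 'k = 'k]
  unfolding normal_algebras_def by auto

theorem mainTheorem6:
  fixes i :: nat and C :: "('k::alg_closed_field^3^3^3) set"
  assumes "(U_kronecker i :: ('k^3^3^3) set) \<noteq> {}"
    and "C \<in> irreducible_components_of (subtopology zariski_triples (U_kronecker i))"
  shows "\<exists>m\<in>C. tree_rep kronecker3 (rep m)"
proof -
  let ?U = "U_kronecker i :: ('k^3^3^3) set"
  \<comment> \<open>A piece is contained in \<open>?U\<close> or disjoint from it, so the selected
    pieces still cover \<open>?U\<close>.\<close>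
  define \<P> where "\<P> = {P \<in> piece ` normal_algebras. P \<subseteq> ?U \<and> P \<noteq> {}}"
  have "m \<in> \<Union>\<P>" if m: "m \<in> ?U" for m
  proof -
    have "local_triple m" using m by (simp add: U_kronecker_def indecomposable_iff_local_triple)
    then obtain v where v: "equivalent_triples m v" "intertwiners v \<in> normal_algebras"
      using local_triple_normal_form by blast
    then have "m \<in> piece (intertwiners v)" by (auto simp: piece_def)
    then show ?thesis using piece_subset_U_kronecker[OF _ m] v(2) by (auto simp: \<P>_def)
  qed
  then have "?U = \<Union>\<P>" by (auto simp: \<P>_def)
  moreover have "finite \<P>" by (simp add: \<P>_def normal_algebras_def)
  moreover have "vanishing_prime {\<lambda>m. m $ a $ r $ c | a r c. True} P" if "P \<in> \<P>" for P
    using that vanishing_prime_piece by (auto simp: \<P>_def)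
  ultimately have "\<exists>P\<in>\<P>. P \<subseteq> C"
    by (intro irreducible_component_contains_piece[OF assms(2)[unfolded zariski_triples_def]])
  then obtain P where P: "P \<in> \<P>" "P \<subseteq> C" by blast
  then obtain E where E: "E \<in> normal_algebras" "P = piece E" by (auto simp: \<P>_def)
  then obtain w where "intertwiners w = E" "tree_rep kronecker3 (rep w)"
    using normal_algebra_has_tree by blast
  moreover from this have "w \<in> piece E" using equivalent_triples_refl by (auto simp: piece_def)
  ultimately show ?thesis using P E by blast
qed

end
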